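(* Let $\Omega\subset\mathbb{R}^2$ be an open bounded convex set with area $\mathcal{A}(\Omega)$, and let $F:M^2\to\mathbb{R}^3$ be an immersion with $F(M^2)=\Sigma$, where $\Sigma$ is a smooth, strictly convex, complete surface satisfying \[ K(p)=\frac{2\pi}{\mathcal{A}(\Omega)}\langle \vec n(p),\vec e_3\rangle\quad\text{for all }p\in M^2, \] with $K$ the Gauss curvature, $\vec n$ the interior unit normal and $\vec e_3=(0,0,1)$ (equivalently, $\Sigma$ is the boundary of $\{(x,t):x\in\Omega,\ t\ge u(x)\}$ for a convex solution $u$ of $\det D^2u/(1+|Du|^2)^{3/2}=2\pi/\mathcal{A}(\Omega)$ in $\Omega$ with $|Du|\to\infty$ at $\partial\Omega$). Let $B_R(Y)\subset\mathbb{R}^3$ be a ball and let $\Sigma_c$ be a compact surface with boundary such that $\Sigma_c\subset\Sigma$ and $\partial\Sigma_c\subset\partial B_R(Y)$. Define $\eta:M^2\to\mathbb{R}$ by $\eta(p)=(|F(p)-Y|^2-R^2)_+$ and let $\Lambda(p)=\max\{\lambda_1(p),\lambda_2(p)\}$ be the largest principal curvature of $\Sigma$ at $F(p)$. Then for every $p\in M^2$ with $F(p)\in\Sigma_c$, \[ \eta\Lambda(p)\le\frac{9\pi}{\mathcal{A}(\Omega)}\sup_{F(q)\in\Sigma_c}|F(q)-Y|^3 . \]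
   Context: $(\cdot)_+$ denotes the positive part. $\lambda_1,\lambda_2$ are the principal curvatures of $\Sigma$. *)

theory Defs
  imports "HOL-Analysis.Analysis"
begin

definition pd1 :: "(real \<times> real \<Rightarrow> real) \<Rightarrow> real \<times> real \<Rightarrow> real" where
  "pd1 f = (\<lambda>x. deriv (\<lambda>t. f (t, snd x)) (fst x))"

definition pd2 :: "(real \<times> real \<Rightarrow> real) \<Rightarrow> real \<times> real \<Rightarrow> real" where
  "pd2 f = (\<lambda>x. deriv (\<lambda>t. f (fst x, t)) (snd x))"

fun dpart :: "bool list \<Rightarrow> (real \<times> real \<Rightarrow> real) \<Rightarrow> real \<times> real \<Rightarrow> real" where
  "dpart [] f = f"
| "dpart (b # bs) f = (if b then pd1 else pd2) (dpart bs f)"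

definition smooth2_on :: "(real \<times> real) set \<Rightarrow> (real \<times> real \<Rightarrow> real) \<Rightarrow> bool" where
  "smooth2_on S f \<longleftrightarrow> (\<forall>bs. continuous_on S (dpart bs f) \<and>
     (\<forall>x\<in>S. (\<lambda>t. dpart bs f (t, snd x)) differentiable (at (fst x)) \<and>
             (\<lambda>t. dpart bs f (fst x, t)) differentiable (at (snd x))))"

definition graph_map :: "(real \<times> real \<Rightarrow> real) \<Rightarrow> real \<times> real \<Rightarrow> real \<times> real \<times> real" where
  "graph_map u x = (fst x, snd x, u x)"

definition graph_W :: "(real \<times> real \<Rightarrow> real) \<Rightarrow> real \<times> real \<Rightarrow> real" where
  "graph_W u x = sqrt (1 + (pd1 u x)\<^sup>2 + (pd2 u x)\<^sup>2)"

text \<open>Interior (upward) unit normal of the boundary of the epigraph.\<close>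
definition graph_normal :: "(real \<times> real \<Rightarrow> real) \<Rightarrow> real \<times> real \<Rightarrow> real \<times> real \<times> real" where
  "graph_normal u x = (- pd1 u x / graph_W u x, - pd2 u x / graph_W u x, 1 / graph_W u x)"

definition e3 :: "real \<times> real \<times> real" where "e3 = (0, 0, 1)"

definition graph_gauss :: "(real \<times> real \<Rightarrow> real) \<Rightarrow> real \<times> real \<Rightarrow> real" where
  "graph_gauss u x =
     (pd1 (pd1 u) x * pd2 (pd2 u) x - (pd1 (pd2 u) x)\<^sup>2) / (graph_W u x) ^ 4"

definition graph_mean :: "(real \<times> real \<Rightarrow> real) \<Rightarrow> real \<times> real \<Rightarrow> real" where
  "graph_mean u x =
     ((1 + (pd2 u x)\<^sup>2) * pd1 (pd1 u) x - 2 * pd1 u x * pd2 u x * pd1 (pd2 u) x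
      + (1 + (pd1 u x)\<^sup>2) * pd2 (pd2 u) x) / (2 * (graph_W u x) ^ 3)"

text \<open>Principal curvatures: the two roots of \<lambda>^2 - 2 H \<lambda> + K = 0.\<close>
definition princ1 :: "(real \<times> real \<Rightarrow> real) \<Rightarrow> real \<times> real \<Rightarrow> real" where
  "princ1 u x = graph_mean u x - sqrt ((graph_mean u x)\<^sup>2 - graph_gauss u x)"

definition princ2 :: "(real \<times> real \<Rightarrow> real) \<Rightarrow> real \<times> real \<Rightarrow> real" where
  "princ2 u x = graph_mean u x + sqrt ((graph_mean u x)\<^sup>2 - graph_gauss u x)"

definition max_princ :: "(real \<times> real \<Rightarrow> real) \<Rightarrow> real \<times> real \<Rightarrow> real" where
  "max_princ u x = max (princ1 u x) (princ2 u x)"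

definition pos_part :: "real \<Rightarrow> real" where "pos_part a = max a 0"

end

theory Submission
  imports Defs
begin

text \<open>
  Let \<open>\<eta> = \<bar>F - Y\<bar>\<^sup>2 - R\<^sup>2\<close>. If the positive part of \<open>\<eta>\<close> times \<open>\<Lambda>\<close> is positive somewhere on the compact piece, it
  attains its maximum at an interior point, because \<open>\<eta>\<close> vanishes on the boundary. Write \<open>\<lambda> = \<Lambda>\<close>
  and \<open>\<mu>\<close> for the principal curvatures there and \<open>a, b\<close> for the principal directions. By the
  Rayleigh characterization of \<open>\<Lambda>\<close>, the quotient \<open>\<eta> h(\<xi>,\<xi>) / g(\<xi>,\<xi>)\<close> has a local maximum at that point
  for every vector field \<open>\<xi>\<close> with value \<open>a\<close>. Take \<open>\<xi>\<close> parallel to first order, apply the second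
  derivative test along the lines in directions \<open>a\<close> and \<open>b\<close> with weights \<open>1/\<lambda>\<close> and \<open>1/\<mu>\<close>, and
  eliminate the fourth derivatives of \<open>u\<close> by differentiating the equation \<open>K = c \<langle>n, e\<^sub>3\<rangle>\<close> twice in direction
  \<open>a\<close>. The third derivatives are determined by the first-order conditions, and what remains is
  \<open>2\<lambda>\<^sup>2 \<le> c\<^sup>2 \<eta> + 8 c S \<lambda>\<close> with \<open>S = \<bar>F - Y\<bar>\<close> at the maximum point. As \<open>\<eta> \<le> S\<^sup>2\<close>, this gives
  \<open>\<eta>\<lambda> \<le> (9/2) c S\<^sup>3\<close>.
\<close>

section \<open>Second-order jets of functions of one variable\<close>

text \<open>What holds eventually in \<open>nhds 0\<close> holds at 0 itself, so \<open>f1\<close>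
  and \<open>f2\<close> are the first two derivatives of \<open>f\<close> at 0. As a relation with
  explicit values, jets of composite expressions are computed by rules, without evaluating iterated
  \<open>deriv\<close>.\<close>

definition jet2 :: "(real \<Rightarrow> real) \<Rightarrow> real \<Rightarrow> real \<Rightarrow> real \<Rightarrow> bool" where
  "jet2 f f0 f1 f2 \<longleftrightarrow> f 0 = f0 \<and>
     (\<exists>f'. (\<forall>\<^sub>F t in nhds 0. (f has_real_derivative f' t) (at t)) \<and>
           f' 0 = f1 \<and> (f' has_real_derivative f2) (at 0))"

lemma jet2_const: "jet2 (\<lambda>t. c) c 0 0"
  unfolding jet2_def by (auto intro!: exI[of _ "\<lambda>t. 0"])

lemma jet2_ident: "jet2 (\<lambda>t. t) 0 1 0"
  unfolding jet2_def by (auto intro!: exI[of _ "\<lambda>t. 1"])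

lemma jet2_add:
  assumes "jet2 f f0 f1 f2" "jet2 g g0 g1 g2"
  shows "jet2 (\<lambda>t. f t + g t) (f0 + g0) (f1 + g1) (f2 + g2)"
proof -
  obtain f' g' where
    f': "\<forall>\<^sub>F t in nhds 0. (f has_real_derivative f' t) (at t)" "f' 0 = f1"
      "(f' has_real_derivative f2) (at 0)" and
    g': "\<forall>\<^sub>F t in nhds 0. (g has_real_derivative g' t) (at t)" "g' 0 = g1"
      "(g' has_real_derivative g2) (at 0)"
    using assms unfolding jet2_def by blast
  have "\<forall>\<^sub>F t in nhds 0. ((\<lambda>t. f t + g t) has_real_derivative f' t + g' t) (at t)"
    using f'(1) g'(1) by eventually_elim (auto intro!: derivative_eq_intros)
  moreover have "((\<lambda>t. f' t + g' t) has_real_derivative f2 + g2) (at 0)"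
    using f'(3) g'(3) by (auto intro!: derivative_eq_intros)
  ultimately show ?thesis
    using assms f'(2) g'(2) unfolding jet2_def by auto
qed

lemma jet2_mult:
  assumes "jet2 f f0 f1 f2" "jet2 g g0 g1 g2"
  shows "jet2 (\<lambda>t. f t * g t) (f0 * g0) (f1 * g0 + f0 * g1) (f2 * g0 + 2 * f1 * g1 + f0 * g2)"
proof -
  obtain f' g' where
    f': "\<forall>\<^sub>F t in nhds 0. (f has_real_derivative f' t) (at t)" "f' 0 = f1"
      "(f' has_real_derivative f2) (at 0)" and
    g': "\<forall>\<^sub>F t in nhds 0. (g has_real_derivative g' t) (at t)" "g' 0 = g1"
      "(g' has_real_derivative g2) (at 0)"
    using assms unfolding jet2_def by blast
  have fg: "(f has_real_derivative f1) (at 0)" "(g has_real_derivative g1) (at 0)"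
    using eventually_nhds_x_imp_x[OF f'(1)] eventually_nhds_x_imp_x[OF g'(1)] f'(2) g'(2) by auto
  have "\<forall>\<^sub>F t in nhds 0. ((\<lambda>t. f t * g t) has_real_derivative f' t * g t + f t * g' t) (at t)"
    using f'(1) g'(1) by eventually_elim (auto intro!: derivative_eq_intros)
  moreover have "((\<lambda>t. f' t * g t + f t * g' t) has_real_derivative
      f2 * g0 + 2 * f1 * g1 + f0 * g2) (at 0)"
    using f'(2,3) g'(2,3) fg assms unfolding jet2_def
    by (auto intro!: derivative_eq_intros simp: algebra_simps)
  ultimately show ?thesis
    using assms f'(2) g'(2) unfolding jet2_def by auto
qed

lemma jet2_cmult:
  assumes "jet2 f f0 f1 f2"
  shows "jet2 (\<lambda>t. c * f t) (c * f0) (c * f1) (c * f2)"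
  using jet2_mult[OF jet2_const[of c] assms] by simp

lemma jet2_diff:
  assumes "jet2 f f0 f1 f2" "jet2 g g0 g1 g2"
  shows "jet2 (\<lambda>t. f t - g t) (f0 - g0) (f1 - g1) (f2 - g2)"
  using jet2_add[OF assms(1) jet2_cmult[OF assms(2), of "-1"]] by simp

lemma jet2_square:
  assumes "jet2 f f0 f1 f2"
  shows "jet2 (\<lambda>t. (f t)\<^sup>2) (f0\<^sup>2) (2 * f0 * f1) (2 * f1\<^sup>2 + 2 * f0 * f2)"
  using jet2_mult[OF assms assms] by (simp add: power2_eq_square algebra_simps)

text \<open>Normalized to the value 1 at 0, since it is applied to the squared ratio of
  \<open>W\<close> along a line to \<open>W\<close> at the base point.\<close>

lemma jet2_sqrt:
  assumes "jet2 g 1 g1 g2"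
  shows "jet2 (\<lambda>t. sqrt (g t)) 1 (g1 / 2) (g2 / 2 - g1\<^sup>2 / 4)"
proof -
  obtain g' where
    g': "\<forall>\<^sub>F t in nhds 0. (g has_real_derivative g' t) (at t)" "g' 0 = g1"
      "(g' has_real_derivative g2) (at 0)" and g0: "g 0 = 1"
    using assms unfolding jet2_def by blast
  have gd: "(g has_real_derivative g1) (at 0)"
    using eventually_nhds_x_imp_x[OF g'(1)] g'(2) by auto
  have "(g \<longlongrightarrow> 1) (nhds 0)"
    using DERIV_isCont[OF gd] g0 tendsto_at_iff_tendsto_nhds[of g 0] by (simp add: continuous_at)
  then have "\<forall>\<^sub>F t in nhds 0. g t > 0"
    by (rule order_tendstoD) simp
  then have "\<forall>\<^sub>F t in nhds 0. ((\<lambda>t. sqrt (g t)) has_real_derivative g' t / (2 * sqrt (g t))) (at t)"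
    using g'(1) by eventually_elim (auto intro!: derivative_eq_intros simp: field_simps)
  moreover have "((\<lambda>t. g' t / (2 * sqrt (g t))) has_real_derivative g2 / 2 - g1\<^sup>2 / 4) (at 0)"
    using g'(2,3) gd g0
    by (auto intro!: derivative_eq_intros simp: power2_eq_square field_simps)
  ultimately show ?thesis
    using g0 g'(2) unfolding jet2_def by (auto intro!: exI[of _ "\<lambda>t. g' t / (2 * sqrt (g t))"])
qed

text \<open>This is how an equation is differentiated twice along a line: equality near 0 also holds
  near each nearby point, so it passes to the derivatives.\<close>

lemma jet2_unique:
  assumes "jet2 f f0 f1 f2" "jet2 g g0 g1 g2" and eq: "\<forall>\<^sub>F t in nhds 0. f t = g t"
  shows "f0 = g0" "f1 = g1" "f2 = g2"
proof -
  obtain f' g' where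
    f': "\<forall>\<^sub>F t in nhds 0. (f has_real_derivative f' t) (at t)" "f' 0 = f1"
      "(f' has_real_derivative f2) (at 0)" and
    g': "\<forall>\<^sub>F t in nhds 0. (g has_real_derivative g' t) (at t)" "g' 0 = g1"
      "(g' has_real_derivative g2) (at 0)"
    using assms unfolding jet2_def by blast
  have "\<forall>\<^sub>F t in nhds 0. \<forall>\<^sub>F s in nhds t. f s = g s"
    using eq by (simp add: eventually_eventually)
  then have ev: "\<forall>\<^sub>F t in nhds 0. f' t = g' t"
    using f'(1) g'(1)
  proof eventually_elim
    case (elim t)
    then have "(g has_real_derivative f' t) (at t)"
      using DERIV_cong_ev[OF refl elim(1) refl] by blast
    then show ?case
      using elim(3) DERIV_unique by blast
  qed
  show "f0 = g0"
    using eventually_nhds_x_imp_x[OF eq] assms(1,2) unfolding jet2_def by simp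
  show "f1 = g1"
    using eventually_nhds_x_imp_x[OF ev] f'(2) g'(2) by simp
  have "(g' has_real_derivative f2) (at 0)"
    using DERIV_cong_ev[OF refl ev refl] f'(3) by blast
  then show "f2 = g2"
    using g'(3) DERIV_unique by blast
qed

lemma jet2_local_min:
  assumes "jet2 f f0 f1 f2" and min: "\<forall>\<^sub>F t in nhds 0. f0 \<le> f t"
  shows "f1 = 0" "f2 \<ge> 0"
proof -
  obtain f' where
    f': "\<forall>\<^sub>F t in nhds 0. (f has_real_derivative f' t) (at t)" "f' 0 = f1"
      "(f' has_real_derivative f2) (at 0)" and f0: "f 0 = f0"
    using assms unfolding jet2_def by blast
  obtain d where d: "d > 0" "\<And>t. \<bar>t\<bar> < d \<Longrightarrow> (f has_real_derivative f' t) (at t) \<and> f0 \<le> f t"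
    using eventually_conj[OF f'(1) min] unfolding eventually_nhds_metric
    by (auto simp: dist_real_def)
  show f1: "f1 = 0"
    using DERIV_local_min[of f "f' 0" 0 d] d f0 f'(2) by auto
  \<comment> \<open>If \<open>f2 < 0\<close>, then \<open>f'\<close>, which vanishes at 0, is
    negative just to the right of 0, and the mean value theorem produces a value below the
    minimum.\<close>
  show "f2 \<ge> 0"
  proof (rule ccontr)
    assume "\<not> f2 \<ge> 0"
    then obtain e where e: "e > 0" "\<And>h. 0 < h \<Longrightarrow> h < e \<Longrightarrow> f' h < 0"
      using DERIV_neg_dec_right[OF f'(3)] f'(2) f1 by auto
    define h where "h = min d e / 2"
    have h: "0 < h" "h < d" "h < e"
      using d(1) e(1) by (auto simp: h_def)
    have "\<exists>z::real. 0 < z \<and> z < h \<and> f h - f 0 = (h - 0) * f' z"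
      by (rule MVT2) (use h d(2) in auto)
    then obtain z where "0 < z" "z < h" "f h - f 0 = h * f' z"
      by auto
    moreover have "h * f' z < 0"
      using e(2)[of z] h calculation by (auto simp: mult_pos_neg)
    moreover have "f 0 \<le> f h"
      using d(2)[of h] h f0 by auto
    ultimately show False
      by linarith
  qed
qed

section \<open>Directional derivatives of smooth functions of two variables\<close>

lemma dpart_append: "dpart (as @ bs) f = dpart as (dpart bs f)"
  by (induction as) auto

lemma smooth2_on_pd:
  assumes "smooth2_on S f"
  shows "smooth2_on S (pd1 f)" "smooth2_on S (pd2 f)"
proof -
  have *: "smooth2_on S (dpart [b] f)" for b
    using assms unfolding smooth2_on_def dpart_append[symmetric] by blast
  show "smooth2_on S (pd1 f)" "smooth2_on S (pd2 f)"
    using *[of True] *[of False] by simp_all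
qed

lemma smooth2_onD:
  assumes "smooth2_on S f"
  shows "continuous_on S f"
    and "x \<in> S \<Longrightarrow> ((\<lambda>t. f (t, snd x)) has_real_derivative pd1 f x) (at (fst x))"
    and "x \<in> S \<Longrightarrow> ((\<lambda>t. f (fst x, t)) has_real_derivative pd2 f x) (at (snd x))"
proof -
  note d = spec[OF assms[unfolded smooth2_on_def], of "[]", simplified]
  show "continuous_on S f"
    using d by blast
  show "((\<lambda>t. f (t, snd x)) has_real_derivative pd1 f x) (at (fst x))" if "x \<in> S"
    using d that real_differentiable_def DERIV_deriv_iff_real_differentiable
    unfolding pd1_def by blast
  show "((\<lambda>t. f (fst x, t)) has_real_derivative pd2 f x) (at (snd x))" if "x \<in> S"
    using d that real_differentiable_def DERIV_deriv_iff_real_differentiable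
    unfolding pd2_def by blast
qed

lemma eventually_slices:
  assumes "open S" "x \<in> S"
  shows "\<forall>\<^sub>F t in nhds (fst x). (t, snd x) \<in> S" "\<forall>\<^sub>F t in nhds (snd x). (fst x, t) \<in> S"
proof -
  obtain A B where "open A" "open B" "x \<in> A \<times> B" "A \<times> B \<subseteq> S"
    using open_prod_elim[OF assms] by blast
  then have "fst x \<in> A" "snd x \<in> B" "\<And>t. t \<in> A \<Longrightarrow> (t, snd x) \<in> S" "\<And>t. t \<in> B \<Longrightarrow> (fst x, t) \<in> S"
    by (auto simp: mem_Times_iff subset_iff)
  then show "\<forall>\<^sub>F t in nhds (fst x). (t, snd x) \<in> S" "\<forall>\<^sub>F t in nhds (snd x). (fst x, t) \<in> S"
    unfolding eventually_nhds using \<open>open A\<close> \<open>open B\<close> by blast+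
qed

lemma pd_cong_open:
  assumes "open S" "x \<in> S" and eq: "\<And>y. y \<in> S \<Longrightarrow> f y = g y"
  shows "pd1 f x = pd1 g x" "pd2 f x = pd2 g x"
  unfolding pd1_def pd2_def
  by (auto intro!: deriv_cong_ev eventually_mono[OF eventually_slices(1)[OF assms(1,2)]]
      eventually_mono[OF eventually_slices(2)[OF assms(1,2)]] eq)

text \<open>Openness of \<open>S\<close> makes the inductive identity valid near \<open>x\<close>
  and not only at \<open>x\<close>, as is required before one more derivative is taken.\<close>

lemma dpart_lincomb:
  assumes "open S" "smooth2_on S f" "smooth2_on S g"
  shows "x \<in> S \<Longrightarrow> dpart bs (\<lambda>x. a * f x + b * g x) x = a * dpart bs f x + b * dpart bs g x"
proof (induction bs arbitrary: x)
  case (Cons c bs)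
  have sm: "smooth2_on S (dpart bs f)" "smooth2_on S (dpart bs g)"
    using assms(2,3) unfolding smooth2_on_def dpart_append[symmetric] by blast+
  let ?h = "\<lambda>x. a * dpart bs f x + b * dpart bs g x"
  have "pd1 (dpart bs (\<lambda>x. a * f x + b * g x)) x = pd1 ?h x"
    "pd2 (dpart bs (\<lambda>x. a * f x + b * g x)) x = pd2 ?h x"
    using pd_cong_open[OF assms(1) Cons.prems Cons.IH] by auto
  moreover have "pd1 ?h x = a * pd1 (dpart bs f) x + b * pd1 (dpart bs g) x"
    unfolding pd1_def[of ?h]
    by (intro DERIV_imp_deriv) (auto intro!: derivative_eq_intros smooth2_onD(2) sm Cons.prems)
  moreover have "pd2 ?h x = a * pd2 (dpart bs f) x + b * pd2 (dpart bs g) x"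
    unfolding pd2_def[of ?h]
    by (intro DERIV_imp_deriv) (auto intro!: derivative_eq_intros smooth2_onD(3) sm Cons.prems)
  ultimately show ?case
    by simp
qed simp

lemma smooth2_on_lincomb:
  assumes "open S" "smooth2_on S f" "smooth2_on S g"
  shows "smooth2_on S (\<lambda>x. a * f x + b * g x)"
  unfolding smooth2_on_def
proof (intro allI conjI ballI)
  fix bs x
  let ?h = "\<lambda>x. a * dpart bs f x + b * dpart bs g x"
  have sm: "smooth2_on S (dpart bs f)" "smooth2_on S (dpart bs g)"
    using assms(2,3) unfolding smooth2_on_def dpart_append[symmetric] by blast+
  note eq = dpart_lincomb[OF assms]
  have "continuous_on S ?h"
    by (intro continuous_intros smooth2_onD(1) sm)
  then show "continuous_on S (dpart bs (\<lambda>x. a * f x + b * g x))"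
    by (rule continuous_on_cong[THEN iffD1, rotated 2]) (auto simp: eq)
  assume x: "x \<in> S"
  have "((\<lambda>t. ?h (t, snd x)) has_real_derivative
      a * pd1 (dpart bs f) x + b * pd1 (dpart bs g) x) (at (fst x))"
    by (auto intro!: derivative_eq_intros smooth2_onD(2) sm x)
  then have "((\<lambda>t. dpart bs (\<lambda>x. a * f x + b * g x) (t, snd x)) has_real_derivative
      a * pd1 (dpart bs f) x + b * pd1 (dpart bs g) x) (at (fst x))"
    by (rule DERIV_cong_ev[THEN iffD1, rotated -1])
       (auto intro!: eventually_mono[OF eventually_slices(1)[OF assms(1) x]] simp: eq)
  then show "(\<lambda>t. dpart bs (\<lambda>x. a * f x + b * g x) (t, snd x)) differentiable at (fst x)"
    using real_differentiable_def by blast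
  have "((\<lambda>t. ?h (fst x, t)) has_real_derivative
      a * pd2 (dpart bs f) x + b * pd2 (dpart bs g) x) (at (snd x))"
    by (auto intro!: derivative_eq_intros smooth2_onD(3) sm x)
  then have "((\<lambda>t. dpart bs (\<lambda>x. a * f x + b * g x) (fst x, t)) has_real_derivative
      a * pd2 (dpart bs f) x + b * pd2 (dpart bs g) x) (at (snd x))"
    by (rule DERIV_cong_ev[THEN iffD1, rotated -1])
       (auto intro!: eventually_mono[OF eventually_slices(2)[OF assms(1) x]] simp: eq)
  then show "(\<lambda>t. dpart bs (\<lambda>x. a * f x + b * g x) (fst x, t)) differentiable at (snd x)"
    using real_differentiable_def by blast
qed

text \<open>Built from the partial derivatives rather than from a limit, so that it preserves
  \<open>smooth2_on\<close> and can be iterated.\<close>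

definition ddir :: "real \<times> real \<Rightarrow> (real \<times> real \<Rightarrow> real) \<Rightarrow> real \<times> real \<Rightarrow> real" where
  "ddir w f = (\<lambda>x. fst w * pd1 f x + snd w * pd2 f x)"

lemma smooth2_on_ddir: "open S \<Longrightarrow> smooth2_on S f \<Longrightarrow> smooth2_on S (ddir w f)"
  unfolding ddir_def by (intro smooth2_on_lincomb smooth2_on_pd)

text \<open>Continuity of the partial derivatives upgrades separate differentiability to total
  differentiability, on which the chain rule in \<open>ddir_line\<close> rests.\<close>

lemma smooth2_on_has_derivative:
  assumes "open S" "smooth2_on S f" "x \<in> S"
  shows "(f has_derivative (\<lambda>h. ddir h f x)) (at x)"
proof -
  obtain A B' where AB': "open A" "open B'" "x \<in> A \<times> B'" "A \<times> B' \<subseteq> S"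
    using open_prod_elim[OF assms(1,3)] by blast
  \<comment> \<open>The second factor of the box is shrunk to a ball because
    \<open>has_derivative_partialsI\<close> asks for convexity there.\<close>
  then obtain e where e: "e > 0" "ball (snd x) e \<subseteq> B'"
    using openE[of B' "snd x"] by (auto simp: mem_Times_iff)
  define B where "B = ball (snd x) e"
  have AB: "open A" "open B" "convex B" "fst x \<in> A" "snd x \<in> B" "A \<times> B \<subseteq> S"
    using AB' e by (auto simp: B_def mem_Times_iff)
  note at = at_within_open[OF _ open_Times[OF AB(1,2)]]
  have "((\<lambda>(s, t). f (s, t)) has_derivative
      (\<lambda>(h, k). h * pd1 f x + blinfun_scaleR_left (pd2 f (fst x, snd x)) k))
      (at (fst x, snd x) within A \<times> B)"
  proof (rule has_derivative_partialsI)
    show "((\<lambda>s. f (s, snd x)) has_derivative (\<lambda>h. h * pd1 f x)) (at (fst x) within A)"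
      using smooth2_onD(2)[OF assms(2,3)]
      by (auto simp: has_field_derivative_def mult.commute[of _ "pd1 f x"]
          intro: has_derivative_at_withinI)
    show "((\<lambda>t. f (s, t)) has_derivative blinfun_apply (blinfun_scaleR_left (pd2 f (s, t))))
        (at t within B)" if "s \<in> A" "t \<in> B" for s t
      using smooth2_onD(3)[OF assms(2), of "(s, t)"] that AB(6)
      by (auto simp: has_field_derivative_def mult.commute[of _ "pd2 f _"]
          intro: has_derivative_at_withinI)
    have "continuous_on (A \<times> B) (pd2 f)"
      using smooth2_onD(1)[OF smooth2_on_pd(2)[OF assms(2)]] AB(6) continuous_on_subset by blast
    then have "continuous_on (A \<times> B) (\<lambda>(s, t). blinfun_scaleR_left (pd2 f (s, t)))"
      by (auto simp: case_prod_unfold intro!: continuous_intros)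
    then show "continuous (at (fst x, snd x) within A \<times> B)
        (\<lambda>(s, t). blinfun_scaleR_left (pd2 f (s, t)))"
      using AB(4,5) unfolding continuous_on_eq_continuous_within by blast
  qed (use AB in auto)
  moreover have "at (fst x, snd x) within A \<times> B = at x"
    using AB at[of x] by (simp add: mem_Times_iff)
  ultimately show ?thesis
    by (simp add: ddir_def case_prod_unfold mult.commute)
qed

lemma ddir_line:
  assumes "open S" "smooth2_on S f" "x + t *\<^sub>R w \<in> S"
  shows "((\<lambda>t. f (x + t *\<^sub>R w)) has_real_derivative ddir w f (x + t *\<^sub>R w)) (at t)"
proof -
  have "((\<lambda>t. f (x + t *\<^sub>R w)) has_derivative (\<lambda>h. ddir (h *\<^sub>R w) f (x + t *\<^sub>R w))) (at t)"
    by (rule has_derivative_compose[where f = "\<lambda>t. x + t *\<^sub>R w",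
          OF _ smooth2_on_has_derivative[OF assms]])
       (auto intro!: derivative_eq_intros)
  then show ?thesis
    by (rule has_derivative_imp_has_field_derivative) (simp add: ddir_def algebra_simps)
qed

lemma eventually_line:
  fixes x w :: "'a :: real_normed_vector"
  assumes "open S" "x \<in> S"
  shows "\<forall>\<^sub>F t in nhds 0. x + t *\<^sub>R w \<in> S"
proof -
  have "((\<lambda>t. x + t *\<^sub>R w) \<longlongrightarrow> x + 0 *\<^sub>R w) (nhds 0)"
    by (intro tendsto_intros filterlim_ident)
  then show ?thesis
    using topological_tendstoD assms by fastforce
qed

lemma jet2_ddir:
  assumes "open S" "smooth2_on S f" "x \<in> S"
  shows "jet2 (\<lambda>t. f (x + t *\<^sub>R w)) (f x) (ddir w f x) (ddir w (ddir w f) x)"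
  unfolding jet2_def
  using eventually_mono[OF eventually_line[OF assms(1,3), of w] ddir_line[OF assms(1,2), of x _ w]]
    ddir_line[OF assms(1) smooth2_on_ddir[OF assms(1,2)], of x 0 w w] assms(3)
  by (auto intro!: exI[of _ "\<lambda>t. ddir w f (x + t *\<^sub>R w)"])

lemma ddir_cong_open:
  assumes "open S" "x \<in> S" "\<And>y. y \<in> S \<Longrightarrow> f y = g y"
  shows "ddir w f x = ddir w g x"
  using pd_cong_open[OF assms] by (simp add: ddir_def)

text \<open>Schwarz's theorem. The second difference of \<open>f\<close> over a square of side
  \<open>h\<close> equals \<open>h^2\<close> times either mixed derivative at some point of the
  square, and both points tend to \<open>x\<close> as \<open>h\<close> shrinks.\<close>

lemma pd_commute:
  assumes S: "open S" "smooth2_on S f" "x \<in> S"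
  shows "pd1 (pd2 f) x = pd2 (pd1 f) x"
proof -
  let ?F = "\<lambda>h. pd2 (pd1 f) h" and ?G = "\<lambda>h. pd1 (pd2 f) h"
  obtain s t where x: "x = (s, t)" by fastforce
  obtain A B where AB: "open A" "open B" "x \<in> A \<times> B" "A \<times> B \<subseteq> S"
    using open_prod_elim[OF S(1,3)] by blast
  obtain e where e: "e > 0" "cball s e \<subseteq> A" "cball t e \<subseteq> B"
  proof -
    obtain e1 e2 where "e1 > 0" "e2 > 0" "cball s e1 \<subseteq> A" "cball t e2 \<subseteq> B"
      using AB x open_contains_cball[of A] open_contains_cball[of B] by (auto simp: Ball_def) blast
    then show ?thesis
      using that[of "min e1 e2"] by (auto simp: subset_iff)
  qed
  have inS: "(s', t') \<in> S" if "s \<le> s'" "s' \<le> s + e" "t \<le> t'" "t' \<le> t + e" for s' t'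
    using that e AB(4) by (auto simp: subset_iff dist_real_def abs_if)
  have d: "((\<lambda>s. f (s, t')) has_real_derivative pd1 f (s', t')) (at s')"
    "((\<lambda>t. f (s', t)) has_real_derivative pd2 f (s', t')) (at t')"
    "((\<lambda>t. pd1 f (s', t)) has_real_derivative ?F (s', t')) (at t')"
    "((\<lambda>s. pd2 f (s, t')) has_real_derivative ?G (s', t')) (at s')"
    if "(s', t') \<in> S" for s' t'
    using smooth2_onD(2,3)[OF S(2) that] smooth2_onD(3)[OF smooth2_on_pd(1)[OF S(2)] that]
      smooth2_onD(2)[OF smooth2_on_pd(2)[OF S(2)] that] by simp_all
  have ex: "\<exists>y z. y \<in> {s<..<s+h} \<times> {t<..<t+h} \<and> z \<in> {s<..<s+h} \<times> {t<..<t+h} \<and> ?F y = ?G z"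
    if h: "0 < h" "h \<le> e" for h
  proof -
    have "\<exists>z. s < z \<and> z < s + h \<and>
        (f (s+h, t+h) - f (s+h, t)) - (f (s, t+h) - f (s, t)) =
        (s + h - s) * (pd1 f (z, t+h) - pd1 f (z, t))"
      by (rule MVT2[where f = "\<lambda>s'. f (s', t+h) - f (s', t)"])
         ((use h in simp), (intro DERIV_diff d(1) inS; (use h in linarith)))
    then obtain z1 where z1: "s < z1" "z1 < s + h"
        "(f (s+h, t+h) - f (s+h, t)) - (f (s, t+h) - f (s, t)) =
        h * (pd1 f (z1, t+h) - pd1 f (z1, t))"
      by auto
    have "\<exists>z. t < z \<and> z < t + h \<and> pd1 f (z1, t+h) - pd1 f (z1, t) = (t + h - t) * ?F (z1, z)"
      by (rule MVT2[where f = "\<lambda>t'. pd1 f (z1, t')"])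
         ((use h in simp), (intro d(3) inS; (use h z1 in linarith)))
    then obtain z2 where z2: "t < z2" "z2 < t + h"
        "pd1 f (z1, t+h) - pd1 f (z1, t) = h * ?F (z1, z2)"
      by auto
    have "\<exists>z. t < z \<and> z < t + h \<and>
        (f (s+h, t+h) - f (s, t+h)) - (f (s+h, t) - f (s, t)) =
        (t + h - t) * (pd2 f (s+h, z) - pd2 f (s, z))"
      by (rule MVT2[where f = "\<lambda>t'. f (s+h, t') - f (s, t')"])
         ((use h in simp), (intro DERIV_diff d(2) inS; (use h in linarith)))
    then obtain w1 where w1: "t < w1" "w1 < t + h"
        "(f (s+h, t+h) - f (s, t+h)) - (f (s+h, t) - f (s, t)) =
        h * (pd2 f (s+h, w1) - pd2 f (s, w1))"
      by auto
    have "\<exists>z. s < z \<and> z < s + h \<and> pd2 f (s+h, w1) - pd2 f (s, w1) = (s + h - s) * ?G (z, w1)"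
      by (rule MVT2[where f = "\<lambda>s'. pd2 f (s', w1)"])
         ((use h in simp), (intro d(4) inS; (use h w1 in linarith)))
    then obtain w2 where w2: "s < w2" "w2 < s + h"
        "pd2 f (s+h, w1) - pd2 f (s, w1) = h * ?G (w2, w1)"
      by auto
    have "h * (h * ?F (z1, z2)) = h * (h * ?G (w2, w1))"
      using z1(3) z2(3) w1(3) w2(3) by (simp add: algebra_simps)
    then have "?F (z1, z2) = ?G (w2, w1)"
      using h by simp
    then show ?thesis
      using z1 z2 w1 w2 by (intro exI[of _ "(z1, z2)"] exI[of _ "(w2, w1)"]) auto
  qed
  define h where "h n = e / real (Suc n)" for n
  have "\<forall>n. \<exists>y z. y \<in> {s<..<s+h n} \<times> {t<..<t+h n} \<and> z \<in> {s<..<s+h n} \<times> {t<..<t+h n} \<and>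
      ?F y = ?G z"
    using e(1) by (intro allI ex) (auto simp: h_def field_simps)
  then obtain y z where yz: "\<And>n. y n \<in> {s<..<s+h n} \<times> {t<..<t+h n}"
      "\<And>n. z n \<in> {s<..<s+h n} \<times> {t<..<t+h n}" "\<And>n. ?F (y n) = ?G (z n)"
    by metis
  have hlim: "h \<longlonglongrightarrow> 0"
    unfolding h_def using LIMSEQ_Suc[OF lim_const_over_n[of e]] by simp
  have lim: "w \<longlonglongrightarrow> x" if w: "\<And>n. w n \<in> {s<..<s+h n} \<times> {t<..<t+h n}" for w
  proof -
    have b: "s < fst (w n)" "fst (w n) < s + h n" "t < snd (w n)" "snd (w n) < t + h n" for n
      using w[of n] by (auto simp: mem_Times_iff)
    have "(\<lambda>n. fst (w n)) \<longlonglongrightarrow> s"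
      by (rule tendsto_sandwich[of "\<lambda>_. s" _ _ "\<lambda>n. s + h n"])
         (use b hlim tendsto_add[OF tendsto_const hlim, of s] in
           \<open>auto intro!: always_eventually simp: less_imp_le\<close>)
    moreover have "(\<lambda>n. snd (w n)) \<longlonglongrightarrow> t"
      by (rule tendsto_sandwich[of "\<lambda>_. t" _ _ "\<lambda>n. t + h n"])
         (use b hlim tendsto_add[OF tendsto_const hlim, of t] in
           \<open>auto intro!: always_eventually simp: less_imp_le\<close>)
    ultimately show ?thesis
      using tendsto_Pair[of "\<lambda>n. fst (w n)" s sequentially "\<lambda>n. snd (w n)" t] x by simp
  qed
  have cont: "isCont ?F x" "isCont ?G x"
    using smooth2_onD(1)[OF smooth2_on_pd(2)[OF smooth2_on_pd(1)[OF S(2)]]]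
      smooth2_onD(1)[OF smooth2_on_pd(1)[OF smooth2_on_pd(2)[OF S(2)]]] S(1,3)
    by (auto simp: continuous_on_eq_continuous_at)
  have "(\<lambda>n. ?F (y n)) \<longlonglongrightarrow> ?F x" "(\<lambda>n. ?G (z n)) \<longlonglongrightarrow> ?G x"
    using isCont_tendsto_compose[OF cont(1) lim[OF yz(1)]]
      isCont_tendsto_compose[OF cont(2) lim[OF yz(2)]] by auto
  then show ?thesis
    using yz(3) LIMSEQ_unique by simp
qed

lemma pd_lincomb:
  assumes "open S" "smooth2_on S f" "smooth2_on S g" "x \<in> S"
  shows "pd1 (\<lambda>x. a * f x + b * g x) x = a * pd1 f x + b * pd1 g x"
    "pd2 (\<lambda>x. a * f x + b * g x) x = a * pd2 f x + b * pd2 g x"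
  using dpart_lincomb[OF assms, of "[True]"] dpart_lincomb[OF assms, of "[False]"] by simp_all

lemma ddir_ddir:
  assumes "open S" "smooth2_on S f" "x \<in> S"
  shows "ddir w (ddir z f) x = fst w * fst z * pd1 (pd1 f) x
    + (fst w * snd z + snd w * fst z) * pd1 (pd2 f) x + snd w * snd z * pd2 (pd2 f) x"
  unfolding ddir_def pd_lincomb[OF assms(1) smooth2_on_pd[OF assms(2)] assms(3)]
    pd_commute[OF assms]
  by (simp add: algebra_simps)

lemma ddir_commute:
  assumes "open S" "smooth2_on S f" "x \<in> S"
  shows "ddir w (ddir z f) x = ddir z (ddir w f) x"
  unfolding ddir_ddir[OF assms] by simp

section \<open>The second derivative test in a principal frame\<close>

lemma jet2_eq:
  "jet2 f f0 f1 f2 \<Longrightarrow> f0 = g0 \<Longrightarrow> f1 = g1 \<Longrightarrow> f2 = g2 \<Longrightarrow> jet2 f g0 g1 g2"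
  by simp

lemmas jet2_rules = jet2_square jet2_add jet2_diff jet2_mult jet2_sqrt jet2_ident jet2_const

text \<open>
  In the application \<open>q, r\<close> are the derivatives of \<open>u\<close> in the principal directions \<open>a, b\<close>, \<open>\<nu> = 1/W\<close>,
  and \<open>\<kappa> = W\<lambda>\<close>, \<open>\<omega> = W\<mu>\<close> are the second derivatives of \<open>u\<close>. The functions \<open>va, vb, vaa, vab, vbb\<close>
  are the first and second directional derivatives of \<open>u\<close> restricted to the line in direction \<open>a\<close>
  (\<open>wa, \<dots>\<close>: direction \<open>b\<close>), and the square root is the ratio of \<open>W\<close> on the line to \<open>W\<close> at the
  maximum point. \<open>A, B, C\<close> are the components of \<open>F - Y\<close> in the frame formed by the unit principal tangent
  vectors and the normal.
\<close>

lemma max_principle_frame: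
  fixes q r \<nu> \<kappa> \<omega> \<eta>0 A B C :: real
  assumes pos: "\<kappa> > 0" "\<omega> > 0" "\<eta>0 > 0"
    and unit: "q\<^sup>2 + r\<^sup>2 + \<nu>\<^sup>2 = 1"
    and a: "jet2 va q \<kappa> T1" "jet2 vb r 0 T2"
      "jet2 vaa \<kappa> T1 F1" "jet2 vab 0 T2 F2" "jet2 vbb \<omega> T3 F3"
      "jet2 \<eta>a \<eta>0 (2 * A) (2 + 2 * \<kappa> * (q * A + r * B + \<nu> * C))"
    and b: "jet2 wa q 0 T3" "jet2 wb r \<omega> T4"
      "jet2 waa \<kappa> T2 F3" "jet2 wab 0 T3 F4" "jet2 wbb \<omega> T4 F5"
      "jet2 \<eta>b \<eta>0 (2 * B) (2 + 2 * \<omega> * (q * A + r * B + \<nu> * C))"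
    and eq_a: "\<forall>\<^sub>F t in nhds 0. vaa t * vbb t - (vab t)\<^sup>2 = \<kappa> * \<omega> * (sqrt (\<nu>\<^sup>2
      + (1 - r\<^sup>2) * (va t)\<^sup>2 + 2 * q * r * (va t * vb t) + (1 - q\<^sup>2) * (vb t)\<^sup>2)) ^ 3"
    and eq_b: "\<forall>\<^sub>F t in nhds 0. waa t * wbb t - (wab t)\<^sup>2 = \<kappa> * \<omega> * (sqrt (\<nu>\<^sup>2
      + (1 - r\<^sup>2) * (wa t)\<^sup>2 + 2 * q * r * (wa t * wb t) + (1 - q\<^sup>2) * (wb t)\<^sup>2)) ^ 3"
    and max_a: "\<forall>\<^sub>F t in nhds 0. \<forall>\<sigma> \<tau>.
      \<eta>a t * (\<sigma>\<^sup>2 * vaa t + 2 * (\<sigma> * \<tau>) * vab t + \<tau>\<^sup>2 * vbb t) \<le> \<eta>0 * \<kappa> * (sqrt (\<nu>\<^sup>2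
      + (1 - r\<^sup>2) * (va t)\<^sup>2 + 2 * q * r * (va t * vb t) + (1 - q\<^sup>2) * (vb t)\<^sup>2) *
      ((1 - q\<^sup>2) * \<sigma>\<^sup>2 - 2 * q * r * (\<sigma> * \<tau>) + (1 - r\<^sup>2) * \<tau>\<^sup>2 + (\<sigma> * va t + \<tau> * vb t)\<^sup>2))"
    and max_b: "\<forall>\<^sub>F t in nhds 0. \<forall>\<sigma> \<tau>.
      \<eta>b t * (\<sigma>\<^sup>2 * waa t + 2 * (\<sigma> * \<tau>) * wab t + \<tau>\<^sup>2 * wbb t) \<le> \<eta>0 * \<kappa> * (sqrt (\<nu>\<^sup>2
      + (1 - r\<^sup>2) * (wa t)\<^sup>2 + 2 * q * r * (wa t * wb t) + (1 - q\<^sup>2) * (wb t)\<^sup>2) *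
      ((1 - q\<^sup>2) * \<sigma>\<^sup>2 - 2 * q * r * (\<sigma> * \<tau>) + (1 - r\<^sup>2) * \<tau>\<^sup>2 + (\<sigma> * wa t + \<tau> * wb t)\<^sup>2))"
  shows "2 * \<omega> + 2 * \<kappa> \<le> \<kappa> * \<omega> * (\<omega> * \<nu>\<^sup>2 * \<eta>0 + 2 * q * A - 2 * r * B - 4 * \<nu> * C)"
proof -
  have nu2: "\<nu> * \<nu> = 1 - q * q - r * r"
    using unit by (simp add: power2_eq_square)
  define sa where "sa t = sqrt (\<nu>\<^sup>2 + (1 - r\<^sup>2) * (va t)\<^sup>2 + 2 * q * r * (va t * vb t)
    + (1 - q\<^sup>2) * (vb t)\<^sup>2)" for t
  define sb where "sb t = sqrt (\<nu>\<^sup>2 + (1 - r\<^sup>2) * (wa t)\<^sup>2 + 2 * q * r * (wa t * wb t)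
    + (1 - q\<^sup>2) * (wb t)\<^sup>2)" for t
  \<comment> \<open>The value at 0 is \<open>q^2 + r^2 + \<nu>^2\<close>, which is 1 by
    \<open>unit\<close>, so \<open>jet2_sqrt\<close> applies.\<close>
  have "jet2 (\<lambda>t. \<nu>\<^sup>2 + (1 - r\<^sup>2) * (va t)\<^sup>2 + 2 * q * r * (va t * vb t) + (1 - q\<^sup>2) * (vb t)\<^sup>2)
      1 (2 * q * \<kappa>) (2 * (1 - r\<^sup>2) * \<kappa>\<^sup>2 + 2 * q * T1 + 2 * r * T2)"
    by (rule jet2_eq, (rule a jet2_rules)+) (simp_all add: nu2 algebra_simps power2_eq_square)
  from jet2_sqrt[OF this]
  have sa: "jet2 sa 1 (q * \<kappa>) (\<nu>\<^sup>2 * \<kappa>\<^sup>2 + q * T1 + r * T2)"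
    unfolding sa_def[abs_def] by (rule jet2_eq) (simp_all add: nu2 field_simps power2_eq_square)
  have "jet2 (\<lambda>t. \<nu>\<^sup>2 + (1 - r\<^sup>2) * (wa t)\<^sup>2 + 2 * q * r * (wa t * wb t) + (1 - q\<^sup>2) * (wb t)\<^sup>2)
      1 (2 * r * \<omega>) (2 * (1 - q\<^sup>2) * \<omega>\<^sup>2 + 2 * q * T3 + 2 * r * T4)"
    by (rule jet2_eq, (rule b jet2_rules)+) (simp_all add: nu2 algebra_simps power2_eq_square)
  from jet2_sqrt[OF this]
  have sb: "jet2 sb 1 (r * \<omega>) (\<nu>\<^sup>2 * \<omega>\<^sup>2 + q * T3 + r * T4)"
    unfolding sb_def[abs_def] by (rule jet2_eq) (simp_all add: nu2 field_simps power2_eq_square)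

  define S2 where "S2 = \<nu>\<^sup>2 * \<kappa>\<^sup>2 + q * T1 + r * T2"
  have det_a: "jet2 (\<lambda>t. vaa t * vbb t - (vab t)\<^sup>2) (\<kappa> * \<omega>) (T1 * \<omega> + \<kappa> * T3)
      (F1 * \<omega> + 2 * T1 * T3 + \<kappa> * F3 - 2 * T2\<^sup>2)"
    by (rule jet2_eq, (rule a jet2_rules)+) simp_all
  have rhs_a: "jet2 (\<lambda>t. \<kappa> * \<omega> * (sa t * (sa t * sa t))) (\<kappa> * \<omega>) (3 * \<kappa> * \<omega> * (q * \<kappa>))
      (3 * \<kappa> * \<omega> * (S2 + 2 * q\<^sup>2 * \<kappa>\<^sup>2))"
    by (rule jet2_eq, (rule sa jet2_rules)+) (simp_all add: S2_def algebra_simps power2_eq_square)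
  have "\<forall>\<^sub>F t in nhds 0. vaa t * vbb t - (vab t)\<^sup>2 = \<kappa> * \<omega> * (sa t * (sa t * sa t))"
    using eq_a unfolding sa_def[symmetric] by (simp add: power3_eq_cube mult.assoc)
  \<comment> \<open>The equation differentiated once and twice in direction \<open>a\<close>; the
    second derivative ties \<open>F1\<close> to \<open>F3\<close>. In direction \<open>b\<close> one
    derivative suffices, as it only has to determine \<open>T4\<close>.\<close>
  note ea = jet2_unique(2,3)[OF det_a rhs_a this]
  have det_b: "jet2 (\<lambda>t. waa t * wbb t - (wab t)\<^sup>2) (\<kappa> * \<omega>) (T2 * \<omega> + \<kappa> * T4)
      (F3 * \<omega> + 2 * T2 * T4 + \<kappa> * F5 - 2 * T3\<^sup>2)"
    by (rule jet2_eq, (rule b jet2_rules)+) simp_all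
  have rhs_b: "jet2 (\<lambda>t. \<kappa> * \<omega> * (sb t * (sb t * sb t))) (\<kappa> * \<omega>) (3 * \<kappa> * \<omega> * (r * \<omega>))
      (3 * \<kappa> * \<omega> * (\<nu>\<^sup>2 * \<omega>\<^sup>2 + q * T3 + r * T4 + 2 * r\<^sup>2 * \<omega>\<^sup>2))"
    by (rule jet2_eq, (rule sb jet2_rules)+) (simp_all add: algebra_simps power2_eq_square)
  have "\<forall>\<^sub>F t in nhds 0. waa t * wbb t - (wab t)\<^sup>2 = \<kappa> * \<omega> * (sb t * (sb t * sb t))"
    using eq_b unfolding sb_def[symmetric] by (simp add: power3_eq_cube mult.assoc)
  note eb = jet2_unique(2)[OF det_b rhs_b this]

  \<comment> \<open>Christoffel symbols of a graph: \<open>\<sigma> a + \<tau> b\<close> is parallel to first order along the line in direction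
    \<open>a\<close>, whereas along the line in direction \<open>b\<close> the constant vector \<open>a\<close> already is.\<close>
  define \<sigma> where "\<sigma> t = 1 - \<kappa> * q * t" for t
  define \<tau> where "\<tau> t = (- \<kappa> * r) * t" for t
  have st: "jet2 \<sigma> 1 (- \<kappa> * q) 0" "jet2 \<tau> 0 (- \<kappa> * r) 0"
    using jet2_cmult[OF jet2_ident, of "- \<kappa> * r"]
      jet2_diff[OF jet2_const jet2_cmult[OF jet2_ident, of "\<kappa> * q"], of 1]
    by (simp_all add: \<sigma>_def[abs_def] \<tau>_def[abs_def])
  have Qa: "jet2 (\<lambda>t. (1 - q\<^sup>2) * (\<sigma> t)\<^sup>2 - 2 * q * r * (\<sigma> t * \<tau> t) + (1 - r\<^sup>2) * (\<tau> t)\<^sup>2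
      + (\<sigma> t * va t + \<tau> t * vb t)\<^sup>2)
      1 0 (2 * \<kappa>\<^sup>2 * \<nu>\<^sup>2 + 2 * q * T1 - 4 * \<kappa>\<^sup>2 * q\<^sup>2)"
    by (rule jet2_eq, (rule a st jet2_rules)+)
       (simp_all add: nu2 algebra_simps power2_eq_square)
  have Na: "jet2 (\<lambda>t. (\<sigma> t)\<^sup>2 * vaa t + 2 * (\<sigma> t * \<tau> t) * vab t + (\<tau> t)\<^sup>2 * vbb t)
      \<kappa> (T1 - 2 * \<kappa>\<^sup>2 * q) (F1 - 4 * \<kappa> * q * T1 + 2 * \<kappa> ^ 3 * q\<^sup>2 - 4 * \<kappa> * r * T2
        + 2 * \<kappa>\<^sup>2 * r\<^sup>2 * \<omega>)"
    by (rule jet2_eq, (rule a st jet2_rules)+)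
       (simp_all add: algebra_simps power2_eq_square power3_eq_cube)
  have "jet2 (\<lambda>t. \<eta>0 * \<kappa> * (sa t * ((1 - q\<^sup>2) * (\<sigma> t)\<^sup>2 - 2 * q * r * (\<sigma> t * \<tau> t)
      + (1 - r\<^sup>2) * (\<tau> t)\<^sup>2 + (\<sigma> t * va t + \<tau> t * vb t)\<^sup>2))
      - \<eta>a t * ((\<sigma> t)\<^sup>2 * vaa t + 2 * (\<sigma> t * \<tau> t) * vab t + (\<tau> t)\<^sup>2 * vbb t))
      0 (\<eta>0 * \<kappa> * (q * \<kappa>) - 2 * A * \<kappa> - \<eta>0 * (T1 - 2 * \<kappa>\<^sup>2 * q))
      (\<eta>0 * \<kappa> * (S2 + (2 * \<kappa>\<^sup>2 * \<nu>\<^sup>2 + 2 * q * T1 - 4 * \<kappa>\<^sup>2 * q\<^sup>2))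
        - ((2 + 2 * \<kappa> * (q * A + r * B + \<nu> * C)) * \<kappa> + 4 * A * (T1 - 2 * \<kappa>\<^sup>2 * q)
        + \<eta>0 * (F1 - 4 * \<kappa> * q * T1 + 2 * \<kappa> ^ 3 * q\<^sup>2 - 4 * \<kappa> * r * T2 + 2 * \<kappa>\<^sup>2 * r\<^sup>2 * \<omega>)))"
    by (rule jet2_eq, (rule jet2_diff[OF jet2_mult[OF jet2_const jet2_mult[OF sa Qa]]
          jet2_mult[OF a(6) Na]])) (simp_all add: S2_def)
  moreover have "\<forall>\<^sub>F t in nhds 0. 0 \<le> \<eta>0 * \<kappa> * (sa t * ((1 - q\<^sup>2) * (\<sigma> t)\<^sup>2
      - 2 * q * r * (\<sigma> t * \<tau> t) + (1 - r\<^sup>2) * (\<tau> t)\<^sup>2 + (\<sigma> t * va t + \<tau> t * vb t)\<^sup>2))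
      - \<eta>a t * ((\<sigma> t)\<^sup>2 * vaa t + 2 * (\<sigma> t * \<tau> t) * vab t + (\<tau> t)\<^sup>2 * vbb t)"
    by (rule eventually_mono[OF max_a]) (simp add: sa_def)
  ultimately have ma:
    "\<eta>0 * \<kappa> * (q * \<kappa>) - 2 * A * \<kappa> - \<eta>0 * (T1 - 2 * \<kappa>\<^sup>2 * q) = 0"
    "\<eta>0 * \<kappa> * (S2 + (2 * \<kappa>\<^sup>2 * \<nu>\<^sup>2 + 2 * q * T1 - 4 * \<kappa>\<^sup>2 * q\<^sup>2))
        - ((2 + 2 * \<kappa> * (q * A + r * B + \<nu> * C)) * \<kappa> + 4 * A * (T1 - 2 * \<kappa>\<^sup>2 * q)
        + \<eta>0 * (F1 - 4 * \<kappa> * q * T1 + 2 * \<kappa> ^ 3 * q\<^sup>2 - 4 * \<kappa> * r * T2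
        + 2 * \<kappa>\<^sup>2 * r\<^sup>2 * \<omega>)) \<ge> 0"
    using jet2_local_min by blast+

  have "jet2 (\<lambda>t. \<eta>0 * \<kappa> * (sb t * ((1 - q\<^sup>2) + (wa t)\<^sup>2)) - \<eta>b t * waa t)
      0 (\<eta>0 * \<kappa> * (r * \<omega>) - 2 * B * \<kappa> - \<eta>0 * T2)
      (\<eta>0 * \<kappa> * (\<nu>\<^sup>2 * \<omega>\<^sup>2 + q * T3 + r * T4 + 2 * q * T3)
        - ((2 + 2 * \<omega> * (q * A + r * B + \<nu> * C)) * \<kappa> + 4 * B * T2 + \<eta>0 * F3))"
    by (rule jet2_eq, (rule b sb jet2_rules)+) (simp_all add: algebra_simps)
  moreover have "\<forall>\<^sub>F t in nhds 0.
      0 \<le> \<eta>0 * \<kappa> * (sb t * ((1 - q\<^sup>2) + (wa t)\<^sup>2)) - \<eta>b t * waa t"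
    by (rule eventually_mono[OF max_b], drule spec[of _ 1], drule spec[of _ 0]) (simp add: sb_def)
  ultimately have mb:
    "\<eta>0 * \<kappa> * (r * \<omega>) - 2 * B * \<kappa> - \<eta>0 * T2 = 0"
    "\<eta>0 * \<kappa> * (\<nu>\<^sup>2 * \<omega>\<^sup>2 + q * T3 + r * T4 + 2 * q * T3)
        - ((2 + 2 * \<omega> * (q * A + r * B + \<nu> * C)) * \<kappa> + 4 * B * T2 + \<eta>0 * F3) \<ge> 0"
    using jet2_local_min by blast+

  \<comment> \<open>\<alpha> and \<beta> are the logarithmic derivatives of \<eta> along the two
    lines. In terms of them the first-order conditions give \<open>T1\<close> and \<open>T2\<close>,
    and the once differentiated equation then gives \<open>T3\<close> and \<open>T4\<close>, all as
    polynomials.\<close>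
  define \<alpha> where "\<alpha> = 2 * A / \<eta>0"
  define \<beta> where "\<beta> = 2 * B / \<eta>0"
  have AB: "A = \<alpha> * \<eta>0 / 2" "B = \<beta> * \<eta>0 / 2"
    using pos by (simp_all add: \<alpha>_def \<beta>_def)
  have "\<eta>0 * T1 = \<eta>0 * (\<kappa> * (3 * q * \<kappa> - \<alpha>))"
    using ma(1) unfolding AB by (simp add: algebra_simps power2_eq_square)
  then have T1: "T1 = \<kappa> * (3 * q * \<kappa> - \<alpha>)"
    using pos by simp
  have "\<eta>0 * T2 = \<eta>0 * (\<kappa> * (r * \<omega> - \<beta>))"
    using mb(1) unfolding AB by (simp add: algebra_simps power2_eq_square)
  then have T2: "T2 = \<kappa> * (r * \<omega> - \<beta>)"
    using pos by simp
  have "\<kappa> * T3 = \<kappa> * (\<omega> * \<alpha>)"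
    using ea(1) unfolding T1 by (simp add: algebra_simps power2_eq_square)
  then have T3: "T3 = \<omega> * \<alpha>"
    using pos by simp
  have "\<kappa> * T4 = \<kappa> * (\<omega> * (2 * r * \<omega> + \<beta>))"
    using eb unfolding T2 by (simp add: algebra_simps power2_eq_square)
  then have T4: "T4 = \<omega> * (2 * r * \<omega> + \<beta>)"
    using pos by simp
  have F1: "F1 * \<omega> = 3 * \<kappa> * \<omega> * (S2 + 2 * q\<^sup>2 * \<kappa>\<^sup>2) - 2 * T1 * T3 - \<kappa> * F3 + 2 * T2\<^sup>2"
    using ea(2) by simp
  \<comment> \<open>The weights \<omega> and \<kappa> agree with 1/\<lambda> and 1/\<mu> up to a
    common positive factor. They make the fourth derivatives appear as
    \<open>F1 * \<omega> + \<kappa> * F3\<close>, the combination that the equation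
    controls.\<close>
  have "0 \<le> \<omega> * (\<eta>0 * \<kappa> * (S2 + (2 * \<kappa>\<^sup>2 * \<nu>\<^sup>2 + 2 * q * T1 - 4 * \<kappa>\<^sup>2 * q\<^sup>2))
        - ((2 + 2 * \<kappa> * (q * A + r * B + \<nu> * C)) * \<kappa> + 4 * A * (T1 - 2 * \<kappa>\<^sup>2 * q)
        + \<eta>0 * (F1 - 4 * \<kappa> * q * T1 + 2 * \<kappa> ^ 3 * q\<^sup>2 - 4 * \<kappa> * r * T2 + 2 * \<kappa>\<^sup>2 * r\<^sup>2 * \<omega>)))
      + \<kappa> * (\<eta>0 * \<kappa> * (\<nu>\<^sup>2 * \<omega>\<^sup>2 + q * T3 + r * T4 + 2 * q * T3)
        - ((2 + 2 * \<omega> * (q * A + r * B + \<nu> * C)) * \<kappa> + 4 * B * T2 + \<eta>0 * F3))"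
    using ma(2) mb(2) pos by (intro add_nonneg_nonneg mult_nonneg_nonneg) auto
  \<comment> \<open>Arranged so that the factor of \<open>\<eta>0\<close> in the last term is zero
    by \<open>F1\<close>.\<close>
  also have "\<dots> = \<kappa> * (\<kappa> * \<omega> * (\<omega> * \<nu>\<^sup>2 * \<eta>0 + 2 * q * A - 2 * r * B - 4 * \<nu> * C)
      - 2 * \<omega> - 2 * \<kappa>)
      - \<eta>0 * (F1 * \<omega>
        - (3 * \<kappa> * \<omega> * (S2 + 2 * q\<^sup>2 * \<kappa>\<^sup>2) - 2 * T1 * T3 - \<kappa> * F3 + 2 * T2\<^sup>2))"
    unfolding S2_def T4 T3 T1 T2 AB by (simp add: algebra_simps power2_eq_square power3_eq_cube)
  finally have "0 \<le> \<kappa> * (\<kappa> * \<omega> * (\<omega> * \<nu>\<^sup>2 * \<eta>0 + 2 * q * A - 2 * r * B - 4 * \<nu> * C)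
      - 2 * \<omega> - 2 * \<kappa>)"
    using F1 by simp
  then show ?thesis
    using pos by (simp add: zero_le_mult_iff)
qed

section \<open>Principal curvatures of a graph\<close>

text \<open>With \<open>g\<close> the metric and \<open>h\<close> the Hessian of a graph this
  becomes \<open>K <= H^2\<close>. After multiplication by \<open>g11^2\<close> the difference of
  the two sides is a square plus a positive multiple of a square.\<close>

lemma discriminant_pencil_nonneg:
  fixes g11 g12 g22 h11 h12 h22 :: real
  assumes "g11 > 0" "g11 * g22 - g12\<^sup>2 > 0"
  shows "4 * (g11 * g22 - g12\<^sup>2) * (h11 * h22 - h12\<^sup>2)
    \<le> (g22 * h11 - 2 * g12 * h12 + g11 * h22)\<^sup>2"
proof -
  define B where "B = g11 * h12 - g12 * h11"
  have "g11\<^sup>2 * ((g22 * h11 - 2 * g12 * h12 + g11 * h22)\<^sup>2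
      - 4 * (g11 * g22 - g12\<^sup>2) * (h11 * h22 - h12\<^sup>2))
    = (g11 * (g11 * h22 - g22 * h11) - 2 * g12 * B)\<^sup>2 + 4 * (g11 * g22 - g12\<^sup>2) * B\<^sup>2"
    unfolding B_def by (simp add: power2_eq_square algebra_simps)
  also have "\<dots> \<ge> 0"
    using assms by (intro add_nonneg_nonneg mult_nonneg_nonneg) auto
  finally show ?thesis
    using assms(1) by (simp add: zero_le_mult_iff)
qed

text \<open>A singular form with \<open>m11 > 0\<close> would be positive semidefinite and nonzero,
  so its trace with respect to the positive definite form \<open>g\<close> would be
  positive.\<close>

lemma degenerate_form_diag_nonpos:
  fixes g11 g12 g22 m11 m12 m22 :: real
  assumes "g11 > 0" "g11 * g22 - g12\<^sup>2 > 0"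
    and det: "m11 * m22 = m12\<^sup>2" and tr: "g22 * m11 - 2 * g12 * m12 + g11 * m22 \<le> 0"
  shows "m11 \<le> 0"
proof (rule ccontr)
  assume "\<not> m11 \<le> 0"
  then have m: "m11 > 0" by simp
  have "(g11 * m12 - g12 * m11)\<^sup>2 + (g11 * g22 - g12\<^sup>2) * m11\<^sup>2
      = g11 * (g22 * m11\<^sup>2 - 2 * g12 * m12 * m11 + g11 * m12\<^sup>2)"
    by (simp add: power2_eq_square algebra_simps)
  also have "\<dots> = g11 * m11 * (g22 * m11 - 2 * g12 * m12 + g11 * m22)"
    unfolding det[symmetric] by (simp add: power2_eq_square algebra_simps)
  also have "\<dots> \<le> 0"
    using assms(1) m tr by (simp add: mult_nonneg_nonpos)
  moreover have "(g11 * g22 - g12\<^sup>2) * m11\<^sup>2 > 0"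
    using assms(2) m by simp
  ultimately show False
    by (smt (verit) zero_le_power2)
qed

text \<open>Since \<open>m\<close> is singular, \<open>m11\<close> times the form is a perfect
  square. Applied to \<open>m = h - L g\<close> with \<open>L\<close> the larger root, this yields
  the upper Rayleigh bound.\<close>

lemma degenerate_form_nonpos:
  fixes g11 g12 g22 m11 m12 m22 :: real
  assumes g: "g11 > 0" "g22 > 0" "g11 * g22 - g12\<^sup>2 > 0"
    and det: "m11 * m22 = m12\<^sup>2" and tr: "g22 * m11 - 2 * g12 * m12 + g11 * m22 \<le> 0"
  shows "m11 * s\<^sup>2 + 2 * m12 * (s * t) + m22 * t\<^sup>2 \<le> 0"
proof -
  have m: "m11 \<le> 0" "m22 \<le> 0"
    using degenerate_form_diag_nonpos[OF g(1,3) det tr]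
      degenerate_form_diag_nonpos[of g22 g11 g12 m22 m11 m12] g det tr
    by (simp_all add: mult.commute algebra_simps)
  show ?thesis
  proof (cases "m11 = 0")
    case True
    then show ?thesis
      using det m by (simp add: mult_nonpos_nonneg)
  next
    case False
    have "m11 * (m11 * s\<^sup>2 + 2 * m12 * (s * t) + m22 * t\<^sup>2)
        = m11\<^sup>2 * s\<^sup>2 + 2 * m11 * m12 * (s * t) + (m11 * m22) * t\<^sup>2"
      by (simp add: power2_eq_square algebra_simps)
    also have "\<dots> = (m11 * s + m12 * t)\<^sup>2"
      unfolding det by (simp add: power2_eq_square algebra_simps)
    finally have "m11 * (m11 * s\<^sup>2 + 2 * m12 * (s * t) + m22 * t\<^sup>2) \<ge> 0"
      by simp
    then show ?thesis
      using m(1) False by (simp add: zero_le_mult_iff)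
  qed
qed

text \<open>\<open>L\<close> is an eigenvalue of \<open>h\<close> relative to \<open>g\<close>, and
  \<open>a\<close> a normalized eigenvector. As \<open>h(a,.) = L g(a,.)\<close>, any vector
  \<open>b\<close> that is \<open>g\<close>-orthogonal to \<open>a\<close> is also
  \<open>h\<close>-conjugate to it.\<close>

lemma pencil_frame:
  fixes g11 g12 g22 h11 h12 h22 L w :: real
  assumes g: "g11 > 0" "g22 > 0" "g11 * g22 - g12\<^sup>2 = w\<^sup>2" "w > 0"
    and L: "(h11 - L * g11) * (h22 - L * g22) = (h12 - L * g12)\<^sup>2"
  obtains a1 a2 b1 b2 where
    "g11 * a1\<^sup>2 + 2 * g12 * (a1 * a2) + g22 * a2\<^sup>2 = 1"
    "g11 * b1\<^sup>2 + 2 * g12 * (b1 * b2) + g22 * b2\<^sup>2 = 1"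
    "g11 * (a1 * b1) + g12 * (a1 * b2 + a2 * b1) + g22 * (a2 * b2) = 0"
    "h11 * a1\<^sup>2 + 2 * h12 * (a1 * a2) + h22 * a2\<^sup>2 = L"
    "h11 * (a1 * b1) + h12 * (a1 * b2 + a2 * b1) + h22 * (a2 * b2) = 0"
    "(a1 * b2 - a2 * b1) * w = 1"
proof -
  \<comment> \<open>A kernel vector of the singular matrix \<open>h - L g\<close>: perpendicular to
    its first row, or the first unit vector if that row vanishes.\<close>
  have "\<exists>s t. (s \<noteq> 0 \<or> t \<noteq> 0) \<and> (h11 - L * g11) * s + (h12 - L * g12) * t = 0 \<and>
      (h12 - L * g12) * s + (h22 - L * g22) * t = 0"
  proof (cases "h11 - L * g11 = 0 \<and> h12 - L * g12 = 0")
    case True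
    then show ?thesis by (intro exI[of _ 1] exI[of _ 0]) simp
  next
    case False
    then show ?thesis
      using L by (intro exI[of _ "- (h12 - L * g12)"] exI[of _ "h11 - L * g11"])
        (auto simp: power2_eq_square algebra_simps)
  qed
  then obtain s t where st: "s \<noteq> 0 \<or> t \<noteq> 0"
    "(h11 - L * g11) * s + (h12 - L * g12) * t = 0" "(h12 - L * g12) * s + (h22 - L * g22) * t = 0"
    by blast
  define n where "n = g11 * s\<^sup>2 + 2 * g12 * (s * t) + g22 * t\<^sup>2"
  have "g11 * n = (g11 * s + g12 * t)\<^sup>2 + w\<^sup>2 * t\<^sup>2"
    unfolding n_def g(3)[symmetric] by (simp add: power2_eq_square algebra_simps)
  also have "\<dots> > 0"
  proof (cases "t = 0")
    case True
    then show ?thesis using st(1) g(1) by simp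
  next
    case False
    then show ?thesis using g(4) by (simp add: add_nonneg_pos)
  qed
  finally have n: "n > 0"
    using g(1) by (simp add: zero_less_mult_iff)
  define a1 where "a1 = s / sqrt n"
  define a2 where "a2 = t / sqrt n"
  \<comment> \<open>\<open>b\<close> is \<open>a\<close> rotated by a right angle with respect to
    \<open>g\<close>; \<open>w\<close> is the square root of the determinant of
    \<open>g\<close>.\<close>
  define b1 where "b1 = - (g12 * a1 + g22 * a2) / w"
  define b2 where "b2 = (g11 * a1 + g12 * a2) / w"
  have sn: "sqrt n * sqrt n = n" "sqrt n \<noteq> 0"
    using n by auto
  have sq: "a1\<^sup>2 = s\<^sup>2 / n" "a2\<^sup>2 = t\<^sup>2 / n" "a1 * a2 = s * t / n"
    using n by (simp_all add: a1_def a2_def power_divide)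
  have "g11 * a1\<^sup>2 + 2 * g12 * (a1 * a2) + g22 * a2\<^sup>2 = n / n"
    unfolding sq using arg_cong[OF n_def, of "\<lambda>k. k / n"] by (simp only: add_divide_distrib) simp
  then have aa: "g11 * a1\<^sup>2 + 2 * g12 * (a1 * a2) + g22 * a2\<^sup>2 = 1"
    using n by simp
  have wb: "w * b1 = - (g12 * a1 + g22 * a2)" "w * b2 = g11 * a1 + g12 * a2"
    using g(4) by (simp_all add: b1_def b2_def)
  have "w\<^sup>2 * (g11 * b1\<^sup>2 + 2 * g12 * (b1 * b2) + g22 * b2\<^sup>2)
      = g11 * (w * b1)\<^sup>2 + 2 * g12 * ((w * b1) * (w * b2)) + g22 * (w * b2)\<^sup>2"
    by (simp add: power2_eq_square algebra_simps)
  also have "\<dots> = (g11 * g22 - g12\<^sup>2) * (g11 * a1\<^sup>2 + 2 * g12 * (a1 * a2) + g22 * a2\<^sup>2)"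
    unfolding wb by (simp add: power2_eq_square algebra_simps)
  finally have bb: "g11 * b1\<^sup>2 + 2 * g12 * (b1 * b2) + g22 * b2\<^sup>2 = 1"
    using g(3,4) aa by simp
  have ab: "g11 * (a1 * b1) + g12 * (a1 * b2 + a2 * b1) + g22 * (a2 * b2) = 0"
    using g(4) by (simp add: b1_def b2_def field_simps)
  have k: "h11 * a1 + h12 * a2 = L * (g11 * a1 + g12 * a2)"
    "h12 * a1 + h22 * a2 = L * (g12 * a1 + g22 * a2)"
    using st(2,3) sn by (simp_all add: a1_def a2_def field_simps)
  have "h11 * a1\<^sup>2 + 2 * h12 * (a1 * a2) + h22 * a2\<^sup>2
      = (h11 * a1 + h12 * a2) * a1 + (h12 * a1 + h22 * a2) * a2"
    by (simp add: power2_eq_square algebra_simps)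
  also have "\<dots> = L * (g11 * a1\<^sup>2 + 2 * g12 * (a1 * a2) + g22 * a2\<^sup>2)"
    unfolding k by (simp add: power2_eq_square algebra_simps)
  finally have haa: "h11 * a1\<^sup>2 + 2 * h12 * (a1 * a2) + h22 * a2\<^sup>2 = L"
    using aa by simp
  have "h11 * (a1 * b1) + h12 * (a1 * b2 + a2 * b1) + h22 * (a2 * b2)
      = (h11 * a1 + h12 * a2) * b1 + (h12 * a1 + h22 * a2) * b2"
    by (simp add: algebra_simps)
  also have "\<dots> = L * (g11 * (a1 * b1) + g12 * (a1 * b2 + a2 * b1) + g22 * (a2 * b2))"
    unfolding k by (simp add: algebra_simps)
  finally have hab: "h11 * (a1 * b1) + h12 * (a1 * b2 + a2 * b1) + h22 * (a2 * b2) = 0"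
    using ab by simp
  have "(a1 * b2 - a2 * b1) * w = g11 * a1\<^sup>2 + 2 * g12 * (a1 * a2) + g22 * a2\<^sup>2"
    using g(4) by (simp add: b1_def b2_def field_simps power2_eq_square)
  then show ?thesis
    using that[OF aa bb ab haa hab] aa by simp
qed

section \<open>Curvatures of a graph through its metric and Hessian\<close>

lemma graph_W_pos: "graph_W u x > 0"
  unfolding graph_W_def by (smt (verit) real_sqrt_gt_zero zero_le_power2)

lemma graph_W_sq: "(graph_W u x)\<^sup>2 = 1 + (pd1 u x)\<^sup>2 + (pd2 u x)\<^sup>2"
  unfolding graph_W_def by (simp add: add_nonneg_nonneg)

lemma graph_metric:
  fixes p1 p2 w :: real
  assumes "w\<^sup>2 = 1 + p1\<^sup>2 + p2\<^sup>2" "w > 0"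
  shows "1 + p1\<^sup>2 > 0" "1 + p2\<^sup>2 > 0" "(1 + p1\<^sup>2) * (1 + p2\<^sup>2) - (p1 * p2)\<^sup>2 = w\<^sup>2"
  using assms by (auto simp: power_mult_distrib algebra_simps add_pos_nonneg)

text \<open>The second fundamental form is the Hessian divided by \<open>W\<close>, so the principal
  curvatures times \<open>W\<close> are the roots of the pencil \<open>h - L g\<close>. The trace
  inequality records that \<open>L\<close> is the larger root.\<close>

lemma graph_curvatures:
  fixes u :: "real \<times> real \<Rightarrow> real" and x :: "real \<times> real"
  defines "w \<equiv> graph_W u x"
    and "h11 \<equiv> pd1 (pd1 u) x" and "h12 \<equiv> pd1 (pd2 u) x" and "h22 \<equiv> pd2 (pd2 u) x"
    and "p1 \<equiv> pd1 u x" and "p2 \<equiv> pd2 u x"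
  defines "L \<equiv> w * max_princ u x"
  shows "(h11 - L * (1 + p1\<^sup>2)) * (h22 - L * (1 + p2\<^sup>2)) = (h12 - L * (p1 * p2))\<^sup>2"
    and "(1 + p2\<^sup>2) * (h11 - L * (1 + p1\<^sup>2)) - 2 * (p1 * p2) * (h12 - L * (p1 * p2))
      + (1 + p1\<^sup>2) * (h22 - L * (1 + p2\<^sup>2)) \<le> 0"
proof -
  have w: "w > 0" "w\<^sup>2 = 1 + p1\<^sup>2 + p2\<^sup>2"
    unfolding w_def p1_def p2_def using graph_W_pos graph_W_sq by blast+
  note g = graph_metric[OF w(2,1)]
  define N where "N = (1 + p2\<^sup>2) * h11 - 2 * (p1 * p2) * h12 + (1 + p1\<^sup>2) * h22"
  define d where "d = h11 * h22 - h12\<^sup>2"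
  define H where "H = graph_mean u x"
  define K where "K = graph_gauss u x"
  have N: "N = 2 * H * w ^ 3"
    using w(1) by (simp add: H_def graph_mean_def N_def w_def h11_def h12_def h22_def
        p1_def p2_def mult.assoc)
  have d: "d = K * w ^ 4"
    using w(1) by (simp add: K_def graph_gauss_def d_def w_def h11_def h12_def h22_def)
  have "4 * w\<^sup>2 * d \<le> N\<^sup>2"
    using discriminant_pencil_nonneg[of "1 + p1\<^sup>2" "1 + p2\<^sup>2" "p1 * p2" h11 h22 h12] g w(1)
    unfolding N_def d_def by simp
  then have "4 * w ^ 6 * K \<le> 4 * w ^ 6 * H\<^sup>2"
    unfolding N d by (simp add: power_mult_distrib eval_nat_numeral algebra_simps)
  then have HK: "K \<le> H\<^sup>2"
    using w(1) by simp
  have lam: "max_princ u x = H + sqrt (H\<^sup>2 - K)"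
    using HK unfolding max_princ_def princ1_def princ2_def H_def K_def by simp
  have root: "(max_princ u x)\<^sup>2 = 2 * H * max_princ u x - K"
    using HK unfolding lam by (simp add: power2_eq_square algebra_simps)
  have "(h11 - L * (1 + p1\<^sup>2)) * (h22 - L * (1 + p2\<^sup>2)) - (h12 - L * (p1 * p2))\<^sup>2
      = ((1 + p1\<^sup>2) * (1 + p2\<^sup>2) - (p1 * p2)\<^sup>2) * L\<^sup>2 - N * L + d"
    unfolding N_def d_def by (simp add: power2_eq_square algebra_simps)
  also have "\<dots> = w\<^sup>2 * w\<^sup>2 * (max_princ u x)\<^sup>2 - N * L + d"
    unfolding g(3) L_def by (simp add: power2_eq_square)
  also have "\<dots> = 0"
    unfolding root N d L_def by (simp add: eval_nat_numeral algebra_simps)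
  finally show "(h11 - L * (1 + p1\<^sup>2)) * (h22 - L * (1 + p2\<^sup>2)) = (h12 - L * (p1 * p2))\<^sup>2"
    by simp
  have "(1 + p2\<^sup>2) * (h11 - L * (1 + p1\<^sup>2)) - 2 * (p1 * p2) * (h12 - L * (p1 * p2))
      + (1 + p1\<^sup>2) * (h22 - L * (1 + p2\<^sup>2))
      = N - 2 * ((1 + p1\<^sup>2) * (1 + p2\<^sup>2) - (p1 * p2)\<^sup>2) * L"
    unfolding N_def by (simp add: power2_eq_square algebra_simps)
  also have "\<dots> = - (2 * w ^ 3 * sqrt (H\<^sup>2 - K))"
    unfolding g(3) N L_def lam by (simp add: eval_nat_numeral algebra_simps)
  also have "\<dots> \<le> 0"
    using HK w(1) by simp
  finally show "(1 + p2\<^sup>2) * (h11 - L * (1 + p1\<^sup>2)) - 2 * (p1 * p2) * (h12 - L * (p1 * p2))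
      + (1 + p1\<^sup>2) * (h22 - L * (1 + p2\<^sup>2)) \<le> 0" .
qed

text \<open>At the larger root, \<open>h - L g\<close> is singular with nonpositive trace, hence
  negative semidefinite.\<close>

lemma max_princ_rayleigh:
  "pd1 (pd1 u) x * s\<^sup>2 + 2 * pd1 (pd2 u) x * (s * t) + pd2 (pd2 u) x * t\<^sup>2
    \<le> graph_W u x * max_princ u x * (s\<^sup>2 + t\<^sup>2 + (pd1 u x * s + pd2 u x * t)\<^sup>2)"
proof -
  let ?L = "graph_W u x * max_princ u x" and ?p1 = "pd1 u x" and ?p2 = "pd2 u x"
  let ?h11 = "pd1 (pd1 u) x" and ?h12 = "pd1 (pd2 u) x" and ?h22 = "pd2 (pd2 u) x"
  note g = graph_metric[OF graph_W_sq graph_W_pos, of u x]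
  have "(1 + ?p1\<^sup>2) * (1 + ?p2\<^sup>2) - (?p1 * ?p2)\<^sup>2 > 0"
    unfolding g(3) using graph_W_pos[of u x] by simp
  from degenerate_form_nonpos[OF g(1,2) this graph_curvatures, of s t]
  show ?thesis
    by (simp add: power2_eq_square algebra_simps)
qed

section \<open>Frame components and the closing quadratic inequality\<close>

text \<open>The basis consists of \<open>a\<close>, \<open>b\<close> and their cross product. The
  first conclusion is Parseval's identity, with \<open>C^2\<close> read as the Gram determinant of
  \<open>d\<close>, \<open>a\<close>, \<open>b\<close>; the second expands the third coordinate of
  \<open>d\<close>.\<close>

lemma orthonormal_pair_completion:
  fixes a1 a2 a3 b1 b2 b3 d1 d2 d3 :: real
  assumes "a1\<^sup>2 + a2\<^sup>2 + a3\<^sup>2 = 1" "b1\<^sup>2 + b2\<^sup>2 + b3\<^sup>2 = 1" "a1 * b1 + a2 * b2 + a3 * b3 = 0"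
  defines "A \<equiv> d1 * a1 + d2 * a2 + d3 * a3" and "B \<equiv> d1 * b1 + d2 * b2 + d3 * b3"
    and "C \<equiv> d1 * (a2 * b3 - a3 * b2) + d2 * (a3 * b1 - a1 * b3) + d3 * (a1 * b2 - a2 * b1)"
  shows "A\<^sup>2 + B\<^sup>2 + C\<^sup>2 = d1\<^sup>2 + d2\<^sup>2 + d3\<^sup>2"
    and "a3 * A + b3 * B + (a1 * b2 - a2 * b1) * C = d3"
proof -
  have "C\<^sup>2 = (d1\<^sup>2 + d2\<^sup>2 + d3\<^sup>2) * ((a1\<^sup>2 + a2\<^sup>2 + a3\<^sup>2) * (b1\<^sup>2 + b2\<^sup>2 + b3\<^sup>2)
      - (a1 * b1 + a2 * b2 + a3 * b3)\<^sup>2) - A\<^sup>2 * (b1\<^sup>2 + b2\<^sup>2 + b3\<^sup>2)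
      + 2 * A * B * (a1 * b1 + a2 * b2 + a3 * b3) - B\<^sup>2 * (a1\<^sup>2 + a2\<^sup>2 + a3\<^sup>2)"
    unfolding A_def B_def C_def by algebra
  then show "A\<^sup>2 + B\<^sup>2 + C\<^sup>2 = d1\<^sup>2 + d2\<^sup>2 + d3\<^sup>2"
    using assms(1-3) by simp
  have "(a1 * b2 - a2 * b1) * C = d3 * ((a1\<^sup>2 + a2\<^sup>2 + a3\<^sup>2) * (b1\<^sup>2 + b2\<^sup>2 + b3\<^sup>2)
      - (a1 * b1 + a2 * b2 + a3 * b3)\<^sup>2) - a3 * A * (b1\<^sup>2 + b2\<^sup>2 + b3\<^sup>2)
      + (a1 * b1 + a2 * b2 + a3 * b3) * (A * b3 + B * a3) - b3 * B * (a1\<^sup>2 + a2\<^sup>2 + a3\<^sup>2)"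
    unfolding A_def B_def C_def by algebra
  then show "a3 * A + b3 * B + (a1 * b2 - a2 * b1) * C = d3"
    using assms(1-3) by simp
qed

lemma norm_graph_map_diff:
  "(norm (graph_map u x - Y))\<^sup>2
    = (fst x - fst Y)\<^sup>2 + (snd x - fst (snd Y))\<^sup>2 + (u x - snd (snd Y))\<^sup>2"
  by (cases Y) (simp add: graph_map_def norm_Pair add_nonneg_nonneg)

text \<open>With \<open>m = \<eta> * l\<close> and \<open>T = c * S^3\<close> the hypotheses give
  \<open>2 m^2 <= T^2 + 8 T m\<close>. Once \<open>m\<close> exceeds \<open>9/2 T\<close>, the
  factor \<open>2 m - 8 T\<close> exceeds \<open>T\<close>, and the inequality fails.\<close>

lemma quadratic_bound:
  fixes c S l \<eta> :: real
  assumes "2 * l\<^sup>2 \<le> c\<^sup>2 * \<eta> + 8 * c * S * l" "0 < l" "0 < \<eta>" "\<eta> \<le> S\<^sup>2" "0 < c" "0 \<le> S"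
  shows "\<eta> * l \<le> 9 / 2 * c * S ^ 3"
proof (rule ccontr)
  define m where "m = \<eta> * l"
  define T where "T = c * S ^ 3"
  assume "\<not> \<eta> * l \<le> 9 / 2 * c * S ^ 3"
  then have m: "m > 9 / 2 * T" and T: "T \<ge> 0"
    using assms by (auto simp: m_def T_def)
  have "2 * m\<^sup>2 = \<eta>\<^sup>2 * (2 * l\<^sup>2)"
    by (simp add: m_def power_mult_distrib)
  also have "\<dots> \<le> \<eta>\<^sup>2 * (c\<^sup>2 * \<eta> + 8 * c * S * l)"
    using assms(1) by (intro mult_left_mono) auto
  also have "\<dots> = c\<^sup>2 * \<eta> ^ 3 + 8 * c * S * m * \<eta>"
    by (simp add: m_def eval_nat_numeral algebra_simps)
  also have "\<dots> \<le> c\<^sup>2 * (S\<^sup>2) ^ 3 + 8 * c * S * m * S\<^sup>2"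
    using assms m T by (intro add_mono mult_left_mono power_mono) auto
  also have "\<dots> = T\<^sup>2 + 8 * T * m"
    by (simp add: T_def eval_nat_numeral algebra_simps)
  finally have "m * (2 * m - 8 * T) \<le> T\<^sup>2"
    by (simp add: power2_eq_square algebra_simps)
  moreover have "m * (2 * m - 8 * T) > 9 / 2 * T * T"
  proof (cases "T = 0")
    case True
    then show ?thesis using m by simp
  next
    case False
    then show ?thesis using m T by (intro mult_strict_mono) auto
  qed
  ultimately show False
    using mult_nonneg_nonneg[OF T T] by (simp add: power2_eq_square)
qed

section \<open>The curvature estimate\<close>

lemma smooth2_on_subset: "smooth2_on S f \<Longrightarrow> T \<subseteq> S \<Longrightarrow> smooth2_on T f"
  unfolding smooth2_on_def using continuous_on_subset by blast

text \<open>For a tangent vector of unit length the second derivative becomes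
  \<open>2 + 2 * d3\<close> times the second derivative of \<open>u\<close>, the form used in
  \<open>max_principle_frame\<close> after \<open>d3\<close> is expanded in the frame.\<close>

lemma jet2_dist_graph:
  fixes x w :: "real \<times> real" and Y :: "real \<times> real \<times> real"
  assumes S: "open S" "smooth2_on S u" "x \<in> S"
  defines "d1 \<equiv> fst x - fst Y" and "d2 \<equiv> snd x - fst (snd Y)" and "d3 \<equiv> u x - snd (snd Y)"
  shows "jet2 (\<lambda>t. (norm (graph_map u (x + t *\<^sub>R w) - Y))\<^sup>2 - R\<^sup>2) (d1\<^sup>2 + d2\<^sup>2 + d3\<^sup>2 - R\<^sup>2)
    (2 * (d1 * fst w + d2 * snd w + d3 * ddir w u x))
    (2 * ((fst w)\<^sup>2 + (snd w)\<^sup>2 + (ddir w u x)\<^sup>2) + 2 * ddir w (ddir w u) x * d3)"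
proof -
  have lin: "jet2 (\<lambda>t. fst (x + t *\<^sub>R w) - fst Y) d1 (fst w) 0"
    "jet2 (\<lambda>t. snd (x + t *\<^sub>R w) - fst (snd Y)) d2 (snd w) 0"
    unfolding d1_def d2_def fst_add snd_add fst_scaleR snd_scaleR real_scaleR_def
    by ((rule jet2_eq, (rule jet2_diff jet2_add jet2_mult jet2_ident jet2_const)+); simp)+
  have u: "jet2 (\<lambda>t. u (x + t *\<^sub>R w) - snd (snd Y)) d3 (ddir w u x) (ddir w (ddir w u) x)"
    using jet2_diff[OF jet2_ddir[OF S, of w] jet2_const] by (simp add: d3_def)
  have "jet2 (\<lambda>t. (fst (x + t *\<^sub>R w) - fst Y)\<^sup>2 + (snd (x + t *\<^sub>R w) - fst (snd Y))\<^sup>2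
      + (u (x + t *\<^sub>R w) - snd (snd Y))\<^sup>2 - R\<^sup>2) (d1\<^sup>2 + d2\<^sup>2 + d3\<^sup>2 - R\<^sup>2)
    (2 * (d1 * fst w + d2 * snd w + d3 * ddir w u x))
    (2 * ((fst w)\<^sup>2 + (snd w)\<^sup>2 + (ddir w u x)\<^sup>2) + 2 * ddir w (ddir w u) x * d3)"
    by (rule jet2_eq, rule jet2_diff[OF jet2_add[OF jet2_add[OF jet2_square[OF lin(1)]
          jet2_square[OF lin(2)]] jet2_square[OF u]] jet2_const]) (simp_all add: algebra_simps)
  then show ?thesis
    unfolding norm_graph_map_diff .
qed

text \<open>The Hessian in the frame \<open>a\<close>, \<open>b\<close> is congruent to the
  coordinate Hessian, so its determinant changes by the squared determinant of the frame.\<close>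

lemma ddir_det:
  assumes "open S" "smooth2_on S u" "x \<in> S"
  shows "ddir a (ddir a u) x * ddir b (ddir b u) x - (ddir a (ddir b u) x)\<^sup>2
    = (fst a * snd b - snd a * fst b)\<^sup>2 *
      (pd1 (pd1 u) x * pd2 (pd2 u) x - (pd1 (pd2 u) x)\<^sup>2)"
  unfolding ddir_ddir[OF assms] by algebra

text \<open>On the neighborhood \<open>S\<close> no positive part is involved. Possible
  nonsmoothness of \<open>max_princ u\<close> at umbilic points is circumvented by differentiating
  only the quadratic forms that it bounds.\<close>

lemma interior_max_estimate:
  fixes u :: "real \<times> real \<Rightarrow> real" and Y :: "real \<times> real \<times> real" and c R :: real
  defines "\<eta> \<equiv> \<lambda>y. (norm (graph_map u y - Y))\<^sup>2 - R\<^sup>2"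
  assumes S: "open S" "smooth2_on S u" "x \<in> S" and c: "c > 0"
    and K: "\<And>y. y \<in> S \<Longrightarrow> graph_gauss u y = c * (graph_normal u y \<bullet> e3)"
    and eta_pos: "\<And>y. y \<in> S \<Longrightarrow> \<eta> y > 0"
    and max: "\<And>y. y \<in> S \<Longrightarrow> \<eta> y * max_princ u y \<le> \<eta> x * max_princ u x"
    and lam: "max_princ u x > 0"
  shows "\<eta> x * max_princ u x \<le> 9 / 2 * c * norm (graph_map u x - Y) ^ 3"
proof -
  define w where "w = graph_W u x"
  define l where "l = max_princ u x"
  have w: "w > 0" and l: "l > 0"
    using graph_W_pos lam by (auto simp: w_def l_def)
  have wsq: "w\<^sup>2 = 1 + (pd1 u x)\<^sup>2 + (pd2 u x)\<^sup>2"
    by (simp add: w_def graph_W_sq)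
  \<comment> \<open>\<open>K\<close> is the Hessian determinant over \<open>W^4\<close> and the
    normal has third component \<open>1/W\<close>, so the equation is of Monge-Ampere type.\<close>
  have det: "pd1 (pd1 u) y * pd2 (pd2 u) y - (pd1 (pd2 u) y)\<^sup>2 = c * (graph_W u y) ^ 3"
    if "y \<in> S" for y
  proof -
    have W: "graph_W u y > 0"
      by (rule graph_W_pos)
    have "(pd1 (pd1 u) y * pd2 (pd2 u) y - (pd1 (pd2 u) y)\<^sup>2) / graph_W u y ^ 4 = c / graph_W u y"
      using K[OF that] by (simp add: graph_gauss_def graph_normal_def e3_def inner_prod_def)
    then have "pd1 (pd1 u) y * pd2 (pd2 u) y - (pd1 (pd2 u) y)\<^sup>2
        = c / graph_W u y * graph_W u y ^ 4"
      using W by (simp add: divide_eq_eq)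
    also have "\<dots> = c * graph_W u y ^ 3"
      using W by (simp add: eval_nat_numeral)
    finally show ?thesis .
  qed

  obtain a1 a2 b1 b2 where fr:
    "(1 + (pd1 u x)\<^sup>2) * a1\<^sup>2 + 2 * (pd1 u x * pd2 u x) * (a1 * a2) + (1 + (pd2 u x)\<^sup>2) * a2\<^sup>2 = 1"
    "(1 + (pd1 u x)\<^sup>2) * b1\<^sup>2 + 2 * (pd1 u x * pd2 u x) * (b1 * b2) + (1 + (pd2 u x)\<^sup>2) * b2\<^sup>2 = 1"
    "(1 + (pd1 u x)\<^sup>2) * (a1 * b1) + (pd1 u x * pd2 u x) * (a1 * b2 + a2 * b1)
      + (1 + (pd2 u x)\<^sup>2) * (a2 * b2) = 0"
    "pd1 (pd1 u) x * a1\<^sup>2 + 2 * pd1 (pd2 u) x * (a1 * a2) + pd2 (pd2 u) x * a2\<^sup>2 = w * l"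
    "pd1 (pd1 u) x * (a1 * b1) + pd1 (pd2 u) x * (a1 * b2 + a2 * b1)
      + pd2 (pd2 u) x * (a2 * b2) = 0"
    "(a1 * b2 - a2 * b1) * w = 1"
    using pencil_frame[OF graph_metric[OF wsq w] w graph_curvatures(1)[of u x, folded w_def l_def]]
    by blast
  define a where "a = (a1, a2)"
  define b where "b = (b1, b2)"
  define q where "q = ddir a u x"
  define r where "r = ddir b u x"
  \<comment> \<open>Third component of the cross product of the unit tangent vectors
    \<open>(a1, a2, q)\<close> and \<open>(b1, b2, r)\<close>, that is, of the unit normal; hence it
    equals \<open>1/w\<close>.\<close>
  define \<nu> where "\<nu> = a1 * b2 - a2 * b1"
  define \<kappa> where "\<kappa> = ddir a (ddir a u) x"
  define \<omega> where "\<omega> = ddir b (ddir b u) x"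
  define d1 where "d1 = fst x - fst Y"
  define d2 where "d2 = snd x - fst (snd Y)"
  define d3 where "d3 = u x - snd (snd Y)"
  have nuw: "\<nu> * w = 1"
    using fr(6) by (simp add: \<nu>_def)
  then have nu: "\<nu> > 0"
    using w by (metis zero_less_mult_pos2 zero_less_one)
  have on: "a1\<^sup>2 + a2\<^sup>2 + q\<^sup>2 = 1" "b1\<^sup>2 + b2\<^sup>2 + r\<^sup>2 = 1" "a1 * b1 + a2 * b2 + q * r = 0"
    using fr(1-3) unfolding q_def r_def a_def b_def ddir_def
    by (simp_all add: power2_eq_square algebra_simps)
  have len: "(fst a)\<^sup>2 + (snd a)\<^sup>2 + (ddir a u x)\<^sup>2 = 1"
    "(fst b)\<^sup>2 + (snd b)\<^sup>2 + (ddir b u x)\<^sup>2 = 1"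
    using on(1,2) unfolding q_def r_def by (simp_all add: a_def b_def)
  have ab: "1 - q\<^sup>2 = a1\<^sup>2 + a2\<^sup>2" "1 - r\<^sup>2 = b1\<^sup>2 + b2\<^sup>2" "q * r = - (a1 * b1 + a2 * b2)"
    using on by (simp_all add: algebra_simps)
  have "\<nu>\<^sup>2 = (a1\<^sup>2 + a2\<^sup>2) * (b1\<^sup>2 + b2\<^sup>2) - (a1 * b1 + a2 * b2)\<^sup>2"
    unfolding \<nu>_def by algebra
  also have "\<dots> = (1 - q\<^sup>2) * (1 - r\<^sup>2) - (q * r)\<^sup>2"
    unfolding ab by (simp only: power2_minus)
  finally have unit: "q\<^sup>2 + r\<^sup>2 + \<nu>\<^sup>2 = 1"
    by (simp add: power_mult_distrib algebra_simps)
  have kap: "\<kappa> = w * l" "ddir a (ddir b u) x = 0"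
    using fr(4,5) unfolding \<kappa>_def ddir_ddir[OF S] a_def b_def
    by (simp_all add: power2_eq_square algebra_simps)
  then have kpos: "\<kappa> > 0"
    using w l by simp
  have "\<kappa> * \<omega> = \<nu>\<^sup>2 * (c * w ^ 3)"
    using ddir_det[OF S, of a b] det[OF S(3)] kap(2)
    by (simp add: \<kappa>_def \<omega>_def a_def b_def \<nu>_def w_def)
  also have "\<dots> = (\<nu> * w)\<^sup>2 * (c * w)"
    by (simp add: eval_nat_numeral algebra_simps)
  finally have ko: "\<kappa> * \<omega> = c * w"
    by (simp add: nuw)
  then have opos: "\<omega> > 0"
    using c w kpos by (metis mult_pos_pos zero_less_mult_pos)
  have etax: "\<eta> x = d1\<^sup>2 + d2\<^sup>2 + d3\<^sup>2 - R\<^sup>2"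
    by (simp add: \<eta>_def norm_graph_map_diff d1_def d2_def d3_def)
  have epos: "\<eta> x > 0"
    using eta_pos S(3) .

  define A where "A = d1 * a1 + d2 * a2 + d3 * q"
  define B where "B = d1 * b1 + d2 * b2 + d3 * r"
  define C where "C = d1 * (a2 * r - q * b2) + d2 * (q * b1 - a1 * r) + d3 * (a1 * b2 - a2 * b1)"
  have ABC: "A\<^sup>2 + B\<^sup>2 + C\<^sup>2 = d1\<^sup>2 + d2\<^sup>2 + d3\<^sup>2" "q * A + r * B + \<nu> * C = d3"
    using orthonormal_pair_completion[OF on, of d1 d2 d3]
    by (simp_all add: A_def B_def C_def \<nu>_def)

  define G where "G y = \<nu>\<^sup>2 + (1 - r\<^sup>2) * (ddir a u y)\<^sup>2 + 2 * q * r * (ddir a u y * ddir b u y)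
    + (1 - q\<^sup>2) * (ddir b u y)\<^sup>2" for y
  \<comment> \<open>As plane vectors, \<open>a\<close> and \<open>b\<close> have squared lengths
    \<open>1 - q^2\<close> and \<open>1 - r^2\<close> and inner product \<open>- q * r\<close>. This
    explains the coefficients when the squared gradient is written through the derivatives along
    \<open>a\<close> and \<open>b\<close>.\<close>
  have G: "sqrt (G y) = \<nu> * graph_W u y" for y
  proof -
    have "G y = \<nu>\<^sup>2 + (b1\<^sup>2 + b2\<^sup>2) * (ddir a u y)\<^sup>2
        + 2 * (q * r) * (ddir a u y * ddir b u y) + (a1\<^sup>2 + a2\<^sup>2) * (ddir b u y)\<^sup>2"
      unfolding G_def ab(1,2) by (simp only: mult.assoc)
    also have "\<dots> = \<nu>\<^sup>2 * (1 + (pd1 u y)\<^sup>2 + (pd2 u y)\<^sup>2)"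
      unfolding ab(3) \<nu>_def ddir_def a_def b_def fst_conv snd_conv by algebra
    finally show ?thesis
      using nu graph_W_pos[of u y]
      by (simp add: real_sqrt_mult graph_W_sq[symmetric])
  qed
  have eq: "ddir a (ddir a u) y * ddir b (ddir b u) y - (ddir a (ddir b u) y)\<^sup>2
      = \<kappa> * \<omega> * (sqrt (G y)) ^ 3" if "y \<in> S" for y
  proof -
    have "\<kappa> * \<omega> * (sqrt (G y)) ^ 3 = c * (\<nu> * w) * (\<nu>\<^sup>2 * graph_W u y ^ 3)"
      unfolding G ko by (simp add: power_mult_distrib eval_nat_numeral algebra_simps)
    also have "\<dots> = \<nu>\<^sup>2 * (c * graph_W u y ^ 3)"
      by (simp add: nuw)
    also have "\<dots> = ddir a (ddir a u) y * ddir b (ddir b u) y - (ddir a (ddir b u) y)\<^sup>2"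
      unfolding ddir_det[OF S(1,2) that] det[OF that] by (simp add: a_def b_def \<nu>_def)
    finally show ?thesis
      by simp
  qed
  \<comment> \<open>Rayleigh bound for the vector \<open>\<sigma> a + \<tau> b\<close> at
    \<open>y\<close>, followed by maximality at \<open>x\<close>. The factor
    \<open>\<nu> * w = 1\<close> is inserted to turn \<open>W\<close> at \<open>y\<close> into the
    ratio \<open>sqrt (G y)\<close>.\<close>
  have ray: "\<eta> y * (\<sigma>\<^sup>2 * ddir a (ddir a u) y + 2 * (\<sigma> * \<tau>) * ddir a (ddir b u) y
        + \<tau>\<^sup>2 * ddir b (ddir b u) y)
      \<le> \<eta> x * \<kappa> * (sqrt (G y) * ((1 - q\<^sup>2) * \<sigma>\<^sup>2 - 2 * q * r * (\<sigma> * \<tau>) + (1 - r\<^sup>2) * \<tau>\<^sup>2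
        + (\<sigma> * ddir a u y + \<tau> * ddir b u y)\<^sup>2))" if y: "y \<in> S" for y \<sigma> \<tau>
  proof -
    define s where "s = \<sigma> * a1 + \<tau> * b1"
    define t where "t = \<sigma> * a2 + \<tau> * b2"
    define Q where "Q = s\<^sup>2 + t\<^sup>2 + (pd1 u y * s + pd2 u y * t)\<^sup>2"
    have "\<sigma>\<^sup>2 * ddir a (ddir a u) y + 2 * (\<sigma> * \<tau>) * ddir a (ddir b u) y
        + \<tau>\<^sup>2 * ddir b (ddir b u) y
      = pd1 (pd1 u) y * s\<^sup>2 + 2 * pd1 (pd2 u) y * (s * t) + pd2 (pd2 u) y * t\<^sup>2"
      unfolding ddir_ddir[OF S(1,2) y] a_def b_def fst_conv snd_conv s_def t_def by algebra
    also have "\<dots> \<le> graph_W u y * max_princ u y * Q"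
      unfolding Q_def by (rule max_princ_rayleigh)
    finally have "\<eta> y * (\<sigma>\<^sup>2 * ddir a (ddir a u) y + 2 * (\<sigma> * \<tau>) * ddir a (ddir b u) y
        + \<tau>\<^sup>2 * ddir b (ddir b u) y) \<le> \<eta> y * (graph_W u y * max_princ u y * Q)"
      using eta_pos[OF y] by simp
    also have "\<dots> = (graph_W u y * Q) * (\<eta> y * max_princ u y)"
      by simp
    also have "\<dots> \<le> (graph_W u y * Q) * (\<eta> x * max_princ u x)"
      using graph_W_pos[of u y] by (intro mult_left_mono max[OF y]) (simp add: Q_def)
    also have "\<dots> = \<eta> x * l * (\<nu> * w) * (graph_W u y * Q)"
      by (simp add: nuw l_def)
    also have "\<dots> = \<eta> x * \<kappa> * (sqrt (G y) * Q)"
      unfolding G kap by simp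
    also have "Q = (a1\<^sup>2 + a2\<^sup>2) * \<sigma>\<^sup>2 - 2 * (q * r) * (\<sigma> * \<tau>) + (b1\<^sup>2 + b2\<^sup>2) * \<tau>\<^sup>2
        + (\<sigma> * ddir a u y + \<tau> * ddir b u y)\<^sup>2"
      unfolding Q_def s_def t_def ab(3) ddir_def a_def b_def fst_conv snd_conv by algebra
    finally show ?thesis
      unfolding ab(1,2) by (simp only: mult.assoc)
  qed

  have sm: "smooth2_on S (ddir w1 u)" "smooth2_on S (ddir w1 (ddir w2 u))" for w1 w2
    using S by (auto intro!: smooth2_on_ddir)
  have com: "ddir w1 (ddir w2 u) y = ddir w2 (ddir w1 u) y" if "y \<in> S" for w1 w2 y
    using ddir_commute[OF S(1,2) that] .
  have com3: "ddir w1 (ddir w2 (ddir w3 u)) y = ddir w2 (ddir w1 (ddir w3 u)) y"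
    "ddir w1 (ddir w2 (ddir w3 u)) y = ddir w1 (ddir w3 (ddir w2 u)) y" if "y \<in> S" for w1 w2 w3 y
    by (rule ddir_commute[OF S(1) sm(1) that]) (rule ddir_cong_open[OF S(1) that com])
  \<comment> \<open>The tests along both lines have to share the fourth derivative \<open>F3\<close>
    for it to cancel against the differentiated equation.\<close>
  have com4: "ddir b (ddir b (ddir a (ddir a u))) x = ddir a (ddir a (ddir b (ddir b u))) x"
  proof -
    have "ddir b (ddir b (ddir a (ddir a u))) x = ddir b (ddir a (ddir b (ddir a u))) x"
      by (rule ddir_cong_open[OF S(1,3) com3(1)])
    also have "\<dots> = ddir b (ddir a (ddir a (ddir b u))) x"
      by (rule ddir_cong_open[OF S(1,3) com3(2)])
    also have "\<dots> = ddir a (ddir b (ddir a (ddir b u))) x"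
      by (rule ddir_commute[OF S(1) sm(2) S(3)])
    also have "\<dots> = ddir a (ddir a (ddir b (ddir b u))) x"
      by (rule ddir_cong_open[OF S(1,3) com3(1)])
    finally show ?thesis .
  qed
  define T1 where "T1 = ddir a (ddir a (ddir a u)) x"
  define T2 where "T2 = ddir a (ddir a (ddir b u)) x"
  define T3 where "T3 = ddir a (ddir b (ddir b u)) x"
  define T4 where "T4 = ddir b (ddir b (ddir b u)) x"
  define F3 where "F3 = ddir a (ddir a (ddir b (ddir b u))) x"
  have T: "ddir b (ddir a (ddir a u)) x = T2" "ddir b (ddir b (ddir a u)) x = T3"
    "ddir b (ddir a (ddir b u)) x = T3"
    using com3[OF S(3)] unfolding T2_def T3_def by metis+
  note jet = jet2_ddir[OF S(1) sm(1) S(3)] jet2_ddir[OF S(1) sm(2) S(3)]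
  note line = eventually_line[OF S(1,3)]
  have "2 * \<omega> + 2 * \<kappa> \<le> \<kappa> * \<omega> * (\<omega> * \<nu>\<^sup>2 * \<eta> x + 2 * q * A - 2 * r * B - 4 * \<nu> * C)"
  proof (rule max_principle_frame[OF kpos opos epos unit])
    show "jet2 (\<lambda>t. ddir a u (x + t *\<^sub>R a)) q \<kappa> T1"
      using jet(1)[of a a] by (simp add: q_def \<kappa>_def T1_def)
    show "jet2 (\<lambda>t. ddir b u (x + t *\<^sub>R a)) r 0 T2"
      using jet(1)[of b a] by (simp add: r_def kap T2_def)
    show "jet2 (\<lambda>t. ddir a (ddir a u) (x + t *\<^sub>R a)) \<kappa> T1 (ddir a (ddir a (ddir a (ddir a u))) x)"
      using jet(2)[of a a a] by (simp add: \<kappa>_def T1_def)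
    show "jet2 (\<lambda>t. ddir a (ddir b u) (x + t *\<^sub>R a)) 0 T2 (ddir a (ddir a (ddir a (ddir b u))) x)"
      using jet(2)[of a b a] by (simp add: kap T2_def)
    show "jet2 (\<lambda>t. ddir b (ddir b u) (x + t *\<^sub>R a)) \<omega> T3 F3"
      using jet(2)[of b b a] by (simp add: \<omega>_def T3_def F3_def)
    show "jet2 (\<lambda>t. \<eta> (x + t *\<^sub>R a)) (\<eta> x) (2 * A)
        (2 + 2 * \<kappa> * (q * A + r * B + \<nu> * C))"
      using jet2_dist_graph[OF S, where Y = Y and w = a and R = R]
      unfolding len(1) ABC(2) etax
      by (simp add: \<eta>_def d1_def d2_def d3_def A_def \<kappa>_def q_def a_def)
    show "jet2 (\<lambda>t. ddir a u (x + t *\<^sub>R b)) q 0 T3"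
      using jet(1)[of a b] com[OF S(3), of b a] by (simp add: q_def kap T)
    show "jet2 (\<lambda>t. ddir b u (x + t *\<^sub>R b)) r \<omega> T4"
      using jet(1)[of b b] by (simp add: r_def \<omega>_def T4_def)
    show "jet2 (\<lambda>t. ddir a (ddir a u) (x + t *\<^sub>R b)) \<kappa> T2 F3"
      using jet(2)[of a a b] by (simp add: \<kappa>_def T F3_def com4)
    show "jet2 (\<lambda>t. ddir a (ddir b u) (x + t *\<^sub>R b)) 0 T3 (ddir b (ddir b (ddir a (ddir b u))) x)"
      using jet(2)[of a b b] by (simp add: kap T)
    show "jet2 (\<lambda>t. ddir b (ddir b u) (x + t *\<^sub>R b)) \<omega> T4 (ddir b (ddir b (ddir b (ddir b u))) x)"
      using jet(2)[of b b b] by (simp add: \<omega>_def T4_def)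
    show "jet2 (\<lambda>t. \<eta> (x + t *\<^sub>R b)) (\<eta> x) (2 * B)
        (2 + 2 * \<omega> * (q * A + r * B + \<nu> * C))"
      using jet2_dist_graph[OF S, where Y = Y and w = b and R = R]
      unfolding len(2) ABC(2) etax
      by (simp add: \<eta>_def d1_def d2_def d3_def B_def \<omega>_def r_def b_def)
  qed (rule eventually_mono[OF line], use eq ray in \<open>unfold G_def, blast\<close>)+
  also have "\<dots> = c * (w * \<omega> * \<nu>\<^sup>2 * \<eta> x + w * (2 * q * A - 2 * r * B - 4 * \<nu> * C))"
    unfolding ko by (simp add: algebra_simps)
  also have "w * \<omega> * \<nu>\<^sup>2 * \<eta> x = \<omega> * \<nu> * \<eta> x * (\<nu> * w)"
    by (simp add: power2_eq_square)
  finally have main: "2 * \<omega> + 2 * \<kappa>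
      \<le> c * (\<omega> * \<nu> * \<eta> x + w * (2 * q * A - 2 * r * B - 4 * \<nu> * C))"
    by (simp add: nuw)

  define D where "D = norm (graph_map u x - Y)"
  have D: "D \<ge> 0" "D\<^sup>2 = A\<^sup>2 + B\<^sup>2 + C\<^sup>2"
    unfolding ABC D_def by (simp_all add: norm_graph_map_diff d1_def d2_def d3_def)
  have prod: "\<bar>s * t\<bar> \<le> D" if "s\<^sup>2 \<le> 1" "t\<^sup>2 \<le> D\<^sup>2" for s t
  proof -
    have "\<bar>s\<bar> \<le> 1" "\<bar>t\<bar> \<le> D"
      using that D(1) abs_le_square_iff[of s 1] abs_le_square_iff[of t D] by auto
    then show ?thesis
      using mult_mono[of "\<bar>s\<bar>" 1 "\<bar>t\<bar>" D] by (simp add: abs_mult)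
  qed
  have sq: "q\<^sup>2 \<le> 1" "r\<^sup>2 \<le> 1" "\<nu>\<^sup>2 \<le> 1" "A\<^sup>2 \<le> D\<^sup>2" "B\<^sup>2 \<le> D\<^sup>2" "C\<^sup>2 \<le> D\<^sup>2"
    unfolding D(2) unit[symmetric] by simp_all
  \<comment> \<open>The constant 8 is \<open>2 + 2 + 4\<close>: by orthonormality \<open>q\<close>,
    \<open>r\<close>, \<nu> are at most 1 and \<open>A\<close>, \<open>B\<close>, \<open>C\<close>
    at most \<open>D\<close> in absolute value.\<close>
  have X: "2 * q * A - 2 * r * B - 4 * \<nu> * C \<le> 8 * D"
    using prod[OF sq(1,4)] prod[OF sq(2,5)] prod[OF sq(3,6)] by (simp add: mult.assoc)
  have "w * l * \<omega> = c * w"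
    using ko kap by simp
  then have om: "l * \<omega> = c"
    using w by simp
  \<comment> \<open>The positive term \<open>2 * \<omega>\<close> is dropped. Multiplication by
    \<open>\<nu> * l\<close> afterwards removes the slope factor \<open>w\<close> through
    \<open>\<nu> * w = 1\<close>.\<close>
  have "2 * \<kappa> \<le> c * (\<omega> * \<nu> * \<eta> x + w * (8 * D))"
    using main opos mult_left_mono[OF X, of w] mult_left_mono[of _ _ c] w c
    by (smt (verit, ccfv_SIG))
  then have "2 * \<kappa> * (\<nu> * l) \<le> c * (\<omega> * \<nu> * \<eta> x + w * (8 * D)) * (\<nu> * l)"
    using nu l by (intro mult_right_mono) auto
  also have "\<dots> = c * ((l * \<omega>) * \<nu>\<^sup>2 * \<eta> x + 8 * D * l * (\<nu> * w))"
    by (simp add: power2_eq_square algebra_simps)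
  also have "\<dots> = c\<^sup>2 * (\<nu>\<^sup>2 * \<eta> x) + 8 * c * D * l"
    unfolding om nuw by (simp add: power2_eq_square algebra_simps)
  also have "\<dots> \<le> c\<^sup>2 * \<eta> x + 8 * c * D * l"
    using sq(3) epos by (simp add: mult_left_mono mult_left_le_one_le)
  also have "2 * \<kappa> * (\<nu> * l) = 2 * l\<^sup>2 * (\<nu> * w)"
    unfolding kap by (simp add: power2_eq_square)
  finally have "2 * l\<^sup>2 \<le> c\<^sup>2 * \<eta> x + 8 * c * D * l"
    by (simp add: nuw)
  moreover have "\<eta> x \<le> D\<^sup>2"
    by (simp add: \<eta>_def D_def)
  ultimately show ?thesis
    using quadratic_bound[of l c "\<eta> x" D] l epos c D(1) by (simp add: D_def l_def)
qed

section \<open>From the interior maximum to the compact piece\<close>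

text \<open>Serves to make the constant \<open>c\<close> positive. Boundedness excludes infinite
  measure, for which the real-valued \<open>measure\<close> returns 0.\<close>

lemma measure_lborel_open_pos:
  fixes S :: "'a :: euclidean_space set"
  assumes "open S" "bounded S" "S \<noteq> {}"
  shows "measure lborel S > 0"
proof (rule ccontr)
  assume "\<not> measure lborel S > 0"
  then have "measure lborel S = 0"
    using zero_less_measure_iff by blast
  moreover have "emeasure lborel S < \<infinity>"
    using emeasure_bounded_finite[OF assms(2)] .
  ultimately have "emeasure lborel S = 0"
    by (simp add: emeasure_eq_ennreal_measure less_top)
  then have "S \<in> null_sets lborel"
    using assms(1) by (auto intro: null_setsI)
  then have "negligible S"
    using negligible_iff_null_sets null_sets_completionI by blast
  then show False
    using open_not_negligible assms by blast
qed

text \<open>The square root causes no difficulty, since \<open>sqrt\<close> is extended to negative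
  arguments as an odd function and is continuous on all reals.\<close>

lemma continuous_on_max_princ:
  assumes "smooth2_on S u"
  shows "continuous_on S (max_princ u)"
proof -
  note d = assms smooth2_on_pd[OF assms]
  note d2 = smooth2_on_pd[OF d(2)] smooth2_on_pd[OF d(3)]
  note cont = smooth2_onD(1)[OF d(2)] smooth2_onD(1)[OF d(3)] smooth2_onD(1)[OF d2(1)]
    smooth2_onD(1)[OF d2(3)] smooth2_onD(1)[OF d2(4)]
  have W: "continuous_on S (graph_W u)"
    unfolding graph_W_def[abs_def] by (intro continuous_intros cont)
  have W0: "graph_W u x \<noteq> 0" for x
    using graph_W_pos[of u x] by simp
  have H: "continuous_on S (graph_mean u)"
    unfolding graph_mean_def[abs_def] by (intro continuous_intros cont W) (use W0 in auto)
  have K: "continuous_on S (graph_gauss u)"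
    unfolding graph_gauss_def[abs_def] by (intro continuous_intros cont W) (use W0 in auto)
  show ?thesis
    unfolding max_princ_def[abs_def] princ1_def[abs_def] princ2_def[abs_def]
    by (intro continuous_intros H K)
qed

theorem theorem3p1:
  fixes \<Omega> :: "(real \<times> real) set" and u :: "real \<times> real \<Rightarrow> real"
    and Y :: "real \<times> real \<times> real" and R :: real and D :: "(real \<times> real) set"
  assumes "open \<Omega>" and "bounded \<Omega>" and "convex \<Omega>" and "\<Omega> \<noteq> {}"
    and "smooth2_on \<Omega> u" and "convex_on \<Omega> u"
    and "\<forall>x\<in>\<Omega>. graph_gauss u x
              = (2 * pi / measure lborel \<Omega>) * (graph_normal u x \<bullet> e3)"
    and "\<forall>z\<in>frontier \<Omega>.
           filterlim (\<lambda>x. sqrt ((pd1 u x)\<^sup>2 + (pd2 u x)\<^sup>2)) at_top (at z within \<Omega>)"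
    and "R > 0"
    and "compact D" and "D \<subseteq> \<Omega>" and "D = closure (interior D)"
    and "\<forall>x\<in>frontier D. graph_map u x \<in> sphere Y R"
  shows "\<forall>p\<in>D. pos_part ((norm (graph_map u p - Y))\<^sup>2 - R\<^sup>2) * max_princ u p
           \<le> (9 * pi / measure lborel \<Omega>) * (SUP q\<in>D. (norm (graph_map u q - Y)) ^ 3)"
proof
  fix p assume p: "p \<in> D"
  define c where "c = 2 * pi / measure lborel \<Omega>"
  define \<eta> where "\<eta> y = (norm (graph_map u y - Y))\<^sup>2 - R\<^sup>2" for y
  define f where "f y = pos_part (\<eta> y) * max_princ u y" for y
  have c: "c > 0"
    using measure_lborel_open_pos[OF assms(1,2,4)] by (simp add: c_def)
  have graph: "continuous_on \<Omega> (graph_map u)"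
    unfolding graph_map_def[abs_def] by (intro continuous_intros smooth2_onD(1)[OF assms(5)])
  have eta: "continuous_on \<Omega> \<eta>"
    unfolding \<eta>_def[abs_def] by (intro continuous_intros graph)
  have "continuous_on \<Omega> f"
    unfolding f_def[abs_def] pos_part_def
    by (intro continuous_intros eta continuous_on_max_princ assms(5))
  then obtain x where x: "x \<in> D" "\<And>y. y \<in> D \<Longrightarrow> f y \<le> f x"
    using continuous_attains_sup[OF assms(10), of f] p continuous_on_subset[OF _ assms(11)] by blast

  define N where "N = (SUP q\<in>D. (norm (graph_map u q - Y)) ^ 3)"
  have "continuous_on D (\<lambda>q. (norm (graph_map u q - Y)) ^ 3)"
    by (intro continuous_intros continuous_on_subset[OF graph assms(11)])
  then have "bdd_above ((\<lambda>q. (norm (graph_map u q - Y)) ^ 3) ` D)"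
    by (intro bounded_imp_bdd_above compact_imp_bounded compact_continuous_image assms(10))
  then have N: "norm (graph_map u x - Y) ^ 3 \<le> N"
    unfolding N_def by (rule cSUP_upper[OF x(1)])
  have "f x \<le> 9 / 2 * c * N"
  proof (cases "f x > 0")
    case False
    \<comment> \<open>\<open>N\<close> is nonnegative because it bounds the cube of a norm from
      above.\<close>
    moreover have "0 \<le> 9 / 2 * c * N"
      using c order_trans[OF _ N] by simp
    ultimately show ?thesis
      by linarith
  next
    case True
    then have pos: "\<eta> x > 0" "max_princ u x > 0"
      by (auto simp: f_def pos_part_def max_def zero_less_mult_iff split: if_splits)
    \<comment> \<open>Over the frontier of \<open>D\<close> the graph lies on the sphere, where
      \<eta> is zero.\<close>
    have "x \<notin> frontier D"
      using assms(13) pos(1) by (auto simp: \<eta>_def dist_norm norm_minus_commute)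
    then have xi: "x \<in> interior D"
      using x(1) closure_subset by (auto simp: frontier_def)
    \<comment> \<open>Intersecting with the set where \<eta> is positive replaces the positive part
      by \<eta> itself near \<open>x\<close>.\<close>
    define S where "S = interior D \<inter> (\<Omega> \<inter> \<eta> -` {0<..})"
    have "open S"
      unfolding S_def by (intro open_Int open_interior continuous_open_preimage eta assms(1)) auto
    moreover have "S \<subseteq> \<Omega>" "S \<subseteq> D" "x \<in> S" "\<And>y. y \<in> S \<Longrightarrow> \<eta> y > 0"
      using interior_subset[of D] xi x(1) assms(11) pos(1) by (auto simp: S_def)
    moreover have "\<eta> y * max_princ u y \<le> \<eta> x * max_princ u x" if "y \<in> S" for y
    proof -
      have "y \<in> D" "\<eta> y > 0"
        using that calculation by blast+
      then show ?thesis
        using x(2)[of y] pos(1) by (simp add: f_def pos_part_def)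
    qed
    ultimately have "\<eta> x * max_princ u x \<le> 9 / 2 * c * norm (graph_map u x - Y) ^ 3"
      unfolding \<eta>_def using assms(7) pos(2) c
      by (intro interior_max_estimate[of S] smooth2_on_subset[OF assms(5)]) (auto simp: c_def)
    also have "\<dots> \<le> 9 / 2 * c * N"
      using N c by simp
    finally show ?thesis
      using pos(1) by (simp add: f_def pos_part_def)
  qed
  then have "f p \<le> 9 / 2 * c * N"
    using x(2)[OF p] by simp
  \<comment> \<open>Here \<open>9/2 * c\<close> with
    \<open>c = 2 * pi / measure lborel \<Omega>\<close> becomes the constant of the claim.\<close>
  then show "pos_part ((norm (graph_map u p - Y))\<^sup>2 - R\<^sup>2) * max_princ u p
      \<le> (9 * pi / measure lborel \<Omega>) * (SUP q\<in>D. (norm (graph_map u q - Y)) ^ 3)"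
    by (simp add: f_def \<eta>_def c_def N_def)
qed

end
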